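(* Let $d\ge1$, $0<\alpha<2$, let $\psi$ be a Bernstein function regularly varying at zero of index $\alpha/2$ with $\psi(0)=0$ and $\psi(1)=1$, and let $p$ be the one-step probability of a random walk $S$ on $\mathbb{Z}^d$ in the class $\mathscr{S}$. Let $p_\psi(x,n)$ be the transition function of the subordinate random walk $S^\psi$. Then $$p_\psi(x,n)\sim p_\psi(0,n)$$ as $n$ and $\|x\|$ tend to infinity in such a way that $n\,\psi(\|x\|^{-2})$ tends to infinity.
   Context: Class $\mathscr{S}$: $p$ is a probability measure on $\mathbb{Z}^d$ with finite support, $\sum_vp(v)v=0$, and for each $x\in\mathbb{Z}^d$ there is $n\in\mathbb{N}$ with $p(x,n)>0$, where $p(\cdot,n)=p^{(n)}$ is the $n$-fold convolution of $p$; $S$ is the random walk started at $0$ with step law $p$. $Q$ is the (positive definite) matrix defined by $\langle Qu,u\rangle=\sum_vp(v)\langle v,u\rangle^2$, and $\|x\|^2=\langle Q^{-1}x,x\rangle$. A Bernstein function is a function $\psi:[0,\infty)\to[0,\infty)$, continuous on $[0,\infty)$ and smooth on $(0,\infty)$, with $(-1)^n\psi^{(n)}(x)\le0$ for all integers $n\ge1$ and $x>0$. It has a representation $\psi(x)=a+bx+\int_{[0,\infty)}(1-e^{-xs})\,d\nu(s)$ with $a,b\ge0$ and $\int\min\{1,s\}\,d\nu(s)<\infty$. It is regularly varying at zero of index $\beta$ if $\psi(x)=x^{\beta}\ell(1/x)$ near $0$, where $\ell(\lambda x)/\ell(x)\to1$ as $x\to\infty$ for every $\lambda>0$. For $k\ge1$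 put $c(\psi,k)=\frac1{k!}\int_{[0,\infty)}t^ke^{-t}\,d\nu(t)+b\,\mathbf 1_{\{k=1\}}$. Let $\tau_n=R_1+\dots+R_n$ with $R_i$ i.i.d., independent of $S$, $\mathbb{P}(R_i=k)=c(\psi,k)$. The subordinate random walk is $S^\psi_n=S_{\tau_n}$ and $p_\psi(x,n)=\mathbb{P}(S^\psi_n=x)=\sum_{k\ge n}p(x,k)\mathbb{P}(\tau_n=k)$. $f\sim g$ in the stated regime means $f/g\to1$ along every sequence $(x_k,n_k)$ in that regime. *)

theory Defs
  imports "HOL-Probability.Probability"
begin

section \<open>Random walks on the integer lattice\<close>

text \<open>
  The law of the sum of \<open>n\<close> independent variables with common law \<open>p\<close>, i.e. the \<open>n\<close>-fold
  convolution of \<open>p\<close>. It is used both for the walk on the lattice and for the random times.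
\<close>

primrec conv_power :: "'a::comm_monoid_add pmf \<Rightarrow> nat \<Rightarrow> 'a pmf" where
  "conv_power p 0 = return_pmf 0"
| "conv_power p (Suc n) =
     bind_pmf (conv_power p n) (\<lambda>s. map_pmf (\<lambda>v. s + v) p)"

definition real_vec :: "int ^ 'd \<Rightarrow> real ^ 'd" where
  "real_vec v = (\<chi> i. real_of_int (v $ i))"

definition walk_class :: "(int ^ 'd) pmf \<Rightarrow> bool" where
  "walk_class p \<longleftrightarrow>
     finite (set_pmf p) \<and>
     (\<Sum>v\<in>set_pmf p. pmf p v *\<^sub>R real_vec v) = 0 \<and>
     (\<forall>x. \<exists>n. pmf (conv_power p n) x > 0)"

definition cov_matrix :: "(int ^ 'd) pmf \<Rightarrow> real ^ 'd ^ 'd" where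
  "cov_matrix p =
     (\<chi> i j. \<Sum>v\<in>set_pmf p. pmf p v * (real_vec v $ i * real_vec v $ j))"

lemma inner_cov_matrix:
  "(cov_matrix p *v u) \<bullet> u = (\<Sum>v\<in>set_pmf p. pmf p v * (real_vec v \<bullet> u)\<^sup>2)"
proof -
  have "(cov_matrix p *v u) \<bullet> u =
      (\<Sum>i\<in>UNIV. \<Sum>j\<in>UNIV. \<Sum>v\<in>set_pmf p.
         pmf p v * ((real_vec v $ i * u $ i) * (real_vec v $ j * u $ j)))"
    by (simp add: cov_matrix_def matrix_vector_mult_def inner_vec_def sum_distrib_left
        mult_ac)
  also have "\<dots> = (\<Sum>i\<in>UNIV. \<Sum>v\<in>set_pmf p. \<Sum>j\<in>UNIV.
         pmf p v * ((real_vec v $ i * u $ i) * (real_vec v $ j * u $ j)))"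
    by (intro sum.cong refl sum.swap)
  also have "\<dots> = (\<Sum>v\<in>set_pmf p. \<Sum>i\<in>UNIV. \<Sum>j\<in>UNIV.
         pmf p v * ((real_vec v $ i * u $ i) * (real_vec v $ j * u $ j)))"
    by (rule sum.swap)
  also have "\<dots> = (\<Sum>v\<in>set_pmf p. pmf p v * (real_vec v \<bullet> u)\<^sup>2)"
    unfolding inner_vec_def inner_real_def power2_eq_square sum_product
    by (simp only: sum_distrib_left)
  finally show ?thesis .
qed

definition walk_norm :: "(int ^ 'd) pmf \<Rightarrow> int ^ 'd \<Rightarrow> real" where
  "walk_norm p x = sqrt ((matrix_inv (cov_matrix p) *v real_vec x) \<bullet> real_vec x)"


section \<open>Bernstein functions\<close>

text \<open>
  A function on \<open>[0,\<infinity>)\<close> is a function on the reals whose values at negative arguments are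
  irrelevant: every condition below only concerns its restriction to \<open>[0,\<infinity>)\<close>, and
  derivatives are only taken at positive points.
\<close>

definition bernstein_function :: "(real \<Rightarrow> real) \<Rightarrow> bool" where
  "bernstein_function \<psi> \<longleftrightarrow>
     (\<forall>x\<ge>0. \<psi> x \<ge> 0) \<and> continuous_on {0..} \<psi> \<and>
     (\<forall>n. \<forall>x>0. (deriv ^^ n) \<psi> differentiable (at x)) \<and>
     (\<forall>n\<ge>1. \<forall>x>0. (-1) ^ n * (deriv ^^ n) \<psi> x \<le> 0)"

text \<open>
  \<open>bernstein_repr \<psi> a b \<nu>\<close> says that \<open>\<psi>\<close> is represented by \<open>a\<close>, \<open>b\<close> and the measure \<open>\<nu>\<close>
  on \<open>[0,\<infinity>)\<close>. Every Bernstein function has such a representation, in which \<open>a\<close>, \<open>b\<close> and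
  \<open>\<nu>\<close> restricted to \<open>(0,\<infinity>)\<close> are unique; an atom of \<open>\<nu>\<close> at \<open>0\<close> affects neither \<open>\<psi>\<close> nor
  the coefficients below.
\<close>

definition bernstein_repr ::
    "(real \<Rightarrow> real) \<Rightarrow> real \<Rightarrow> real \<Rightarrow> real measure \<Rightarrow> bool" where
  "bernstein_repr \<psi> a b \<nu> \<longleftrightarrow>
     a \<ge> 0 \<and> b \<ge> 0 \<and>
     sets \<nu> = sets (restrict_space borel {0..}) \<and>
     integrable \<nu> (\<lambda>s. min 1 s) \<and>
     (\<forall>x\<ge>0. \<psi> x = a + b * x + (\<integral>s. (1 - exp (- x * s)) \<partial>\<nu>))"

definition slowly_varying :: "(real \<Rightarrow> real) \<Rightarrow> bool" where
  "slowly_varying l \<longleftrightarrow> (\<forall>c>0. ((\<lambda>x. l (c * x) / l x) \<longlongrightarrow> 1) at_top)"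

definition regularly_varying_at_zero :: "real \<Rightarrow> (real \<Rightarrow> real) \<Rightarrow> bool" where
  "regularly_varying_at_zero \<beta> \<psi> \<longleftrightarrow>
     (\<exists>l. slowly_varying l \<and>
          (\<forall>\<^sub>F x in at_right 0. \<psi> x = x powr \<beta> * l (1 / x)))"


section \<open>Subordinate random walks\<close>

text \<open>The coefficient \<open>c(\<psi>, k)\<close>, which is only meant for \<open>k \<ge> 1\<close>.\<close>

definition bernstein_coeff :: "real \<Rightarrow> real measure \<Rightarrow> nat \<Rightarrow> real" where
  "bernstein_coeff b \<nu> k =
     (\<integral>t. t ^ k * exp (- t) \<partial>\<nu>) / fact k + (if k = 1 then b else 0)"

text \<open>
  The law of \<open>R\<^sub>1\<close>, which lives on the positive integers. The operator \<^const>\<open>embed_pmf\<close> is only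
  meaningful for nonnegative functions of total mass 1; \<open>pmf_subordinator_step\<close> below shows
  that the normalisation \<open>\<psi> 0 = 0\<close>, \<open>\<psi> 1 = 1\<close> guarantees this.
\<close>

definition subordinator_step :: "real \<Rightarrow> real measure \<Rightarrow> nat pmf" where
  "subordinator_step b \<nu> = embed_pmf (\<lambda>k. if k = 0 then 0 else bernstein_coeff b \<nu> k)"

text \<open>
  The law of \<open>S\<close> at the independent random time \<open>\<tau>\<^sub>n\<close>, where \<open>\<tau>\<^sub>n\<close> is the sum of \<open>n\<close>
  independent copies of \<open>R\<^sub>1\<close>.
\<close>

definition subordinate_walk ::
    "real \<Rightarrow> real measure \<Rightarrow> (int ^ 'd) pmf \<Rightarrow> nat \<Rightarrow> (int ^ 'd) pmf" where
  "subordinate_walk b \<nu> p n =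
     bind_pmf (conv_power (subordinator_step b \<nu>) n) (\<lambda>k. conv_power p k)"

definition subordinate_transition ::
    "real \<Rightarrow> real measure \<Rightarrow> (int ^ 'd) pmf \<Rightarrow> int ^ 'd \<Rightarrow> nat \<Rightarrow> real" where
  "subordinate_transition b \<nu> p x n = pmf (subordinate_walk b \<nu> p n) x"

lemma bernstein_repr_space:
  assumes "bernstein_repr \<psi> a b \<nu>"
  shows "space \<nu> = {0..}"
proof -
  have "sets \<nu> = sets (restrict_space borel {0..})"
    using assms by (simp add: bernstein_repr_def)
  from sets_eq_imp_space_eq[OF this] show ?thesis by (simp add: space_restrict_space)
qed

lemma bernstein_repr_measurable:
  assumes "bernstein_repr \<psi> a b \<nu>" and "f \<in> borel_measurable borel"
  shows "f \<in> borel_measurable \<nu>"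
proof -
  have s: "sets \<nu> = sets (restrict_space borel {0..})"
    using assms by (simp add: bernstein_repr_def)
  show ?thesis
    unfolding measurable_cong_sets[OF s refl]
    by (rule measurable_restrict_space1[OF assms(2)])
qed

lemma bernstein_coeff_integrable:
  assumes r: "bernstein_repr \<psi> a b \<nu>" and k: "k \<ge> 1"
  shows "integrable \<nu> (\<lambda>t. t ^ k * exp (- t))"
proof (rule Bochner_Integration.integrable_bound)
  show "integrable \<nu> (\<lambda>s. fact k * min 1 s)"
    using r by (simp add: bernstein_repr_def)
  show "(\<lambda>t. t ^ k * exp (- t)) \<in> borel_measurable \<nu>"
    by (rule bernstein_repr_measurable[OF r]) simp
  show "AE t in \<nu>. norm (t ^ k * exp (- t)) \<le> norm (fact k * min 1 t)"
  proof (rule AE_I2)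
    fix t assume "t \<in> space \<nu>"
    then have t: "t \<ge> 0" using bernstein_repr_space[OF r] by simp
    have "t ^ k * exp (- t) \<le> fact k * min 1 t"
    proof (cases "t \<le> 1")
      case True
      have "t ^ k * exp (- t) \<le> t ^ 1 * 1"
        using t True k by (intro mult_mono power_decreasing) auto
      also have "\<dots> \<le> fact k * t"
        using t fact_ge_1[of k, where 'a = real] mult_right_mono[of 1 "fact k" t] by simp
      finally show ?thesis using True by simp
    next
      case False
      have "(\<Sum>n\<in>{k}. t ^ n /\<^sub>R fact n) \<le> (\<Sum>n. t ^ n /\<^sub>R fact n)"
        using t by (intro sum_le_suminf summable_exp_generic) auto
      then have "t ^ k / fact k \<le> exp t"
        by (simp add: exp_def field_simps)
      then have "t ^ k * exp (- t) \<le> fact k"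
        by (simp add: exp_minus field_simps)
      then show ?thesis using False by simp
    qed
    then show "norm (t ^ k * exp (- t)) \<le> norm (fact k * min 1 t)"
      using t by (simp add: abs_mult)
  qed
qed

lemma bernstein_coeff_nonneg:
  assumes r: "bernstein_repr \<psi> a b \<nu>"
  shows "bernstein_coeff b \<nu> k \<ge> 0"
proof -
  have "(\<integral>t. t ^ k * exp (- t) \<partial>\<nu>) \<ge> 0"
    using bernstein_repr_space[OF r] by (intro integral_nonneg_AE AE_I2) auto
  then show ?thesis
    using r by (simp add: bernstein_coeff_def bernstein_repr_def)
qed

lemma pmf_subordinator_step:
  assumes r: "bernstein_repr \<psi> a b \<nu>" and "\<psi> 0 = 0" and "\<psi> 1 = 1"
  shows "pmf (subordinator_step b \<nu>) k = (if k = 0 then 0 else bernstein_coeff b \<nu> k)"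
  unfolding subordinator_step_def
proof (rule pmf_embed_pmf)
  let ?c = "\<lambda>k. if k = 0 then 0 else bernstein_coeff b \<nu> k"
  show "\<And>k. 0 \<le> ?c k" using bernstein_coeff_nonneg[OF r] by simp
  let ?g = "\<lambda>k t. t ^ Suc k * exp (- t) / fact (Suc k) :: real"
  have b: "b \<ge> 0" using r by (simp add: bernstein_repr_def)
  have "\<psi> 0 = a" and one: "\<psi> 1 = a + b + (\<integral>s. (1 - exp (- s)) \<partial>\<nu>)"
    using r by (auto simp: bernstein_repr_def)
  then have tot: "b + (\<integral>s. (1 - exp (- s)) \<partial>\<nu>) = 1" using assms by simp
  have gm: "(\<lambda>t. ennreal (?g k t)) \<in> borel_measurable \<nu>" for k
    by (rule bernstein_repr_measurable[OF r]) simp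
  have gi: "(\<integral>\<^sup>+t. ennreal (?g k t) \<partial>\<nu>) = ennreal ((\<integral>t. t ^ Suc k * exp (- t) \<partial>\<nu>) / fact (Suc k))"
    for k
  proof -
    have "integrable \<nu> (?g k)"
      using bernstein_coeff_integrable[OF r, of "Suc k"]
      by (intro integrable_divide_zero) simp
    moreover have "AE t in \<nu>. 0 \<le> ?g k t"
    proof (rule AE_I2)
      fix t assume "t \<in> space \<nu>"
      then have "t \<ge> 0" using bernstein_repr_space[OF r] by simp
      then show "0 \<le> ?g k t" by (intro divide_nonneg_pos mult_nonneg_nonneg zero_le_power) simp_all
    qed
    ultimately have "(\<integral>\<^sup>+t. ennreal (?g k t) \<partial>\<nu>) = ennreal (\<integral>t. ?g k t \<partial>\<nu>)"
      by (rule nn_integral_eq_integral)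
    then show ?thesis by (simp only: integral_divide_zero)
  qed
  have gs: "(\<lambda>k. ?g k t) sums (1 - exp (- t))" for t
  proof -
    have "(\<lambda>n. t ^ n / fact n) sums exp t"
      using exp_converges[of t] by (simp add: field_simps)
    from sums_mult[OF this, of "exp (- t)"]
    have "(\<lambda>n. exp (- t) * (t ^ n / fact n)) sums 1"
      by (simp add: exp_minus field_simps)
    then have "(\<lambda>n. exp (- t) * (t ^ Suc n / fact (Suc n))) sums (1 - exp (- t) * (t ^ 0 / fact 0))"
      by (subst sums_Suc_iff) simp
    then show ?thesis by (simp add: mult_ac)
  qed
  have gsum: "(\<Sum>k. ennreal (?g k t)) = ennreal (1 - exp (- t))" if "t \<in> space \<nu>" for t
  proof -
    have "t \<ge> 0" using that bernstein_repr_space[OF r] by simp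
    then show ?thesis
      using gs[of t] by (intro suminf_ennreal_eq) auto
  qed
  have ei: "integrable \<nu> (\<lambda>s. 1 - exp (- s))"
  proof (rule Bochner_Integration.integrable_bound)
    show "integrable \<nu> (\<lambda>s. min 1 s)" using r by (simp add: bernstein_repr_def)
    show "(\<lambda>s. 1 - exp (- s)) \<in> borel_measurable \<nu>"
      by (rule bernstein_repr_measurable[OF r]) simp
    show "AE s in \<nu>. norm (1 - exp (- s)) \<le> norm (min 1 s)"
    proof (rule AE_I2)
      fix s assume "s \<in> space \<nu>"
      then have "s \<ge> 0" using bernstein_repr_space[OF r] by simp
      then show "norm (1 - exp (- s)) \<le> norm (min 1 s)"
        using exp_ge_add_one_self[of "- s"] by auto
    qed
  qed
  have pos1: "AE s in \<nu>. 0 \<le> 1 - exp (- s)"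
    by (rule AE_I2) (simp add: bernstein_repr_space[OF r])
  then have nn1: "0 \<le> (\<integral>s. (1 - exp (- s)) \<partial>\<nu>)"
    by (rule integral_nonneg_AE)
  have "(\<integral>\<^sup>+k. ennreal (?c k) \<partial>count_space UNIV) = (\<Sum>k. ennreal (?c k))"
    by (rule nn_integral_count_space_nat)
  also have "\<dots> = (\<Sum>k. ennreal (?c (Suc k))) + ennreal (?c 0)"
    using suminf_offset[of "\<lambda>k. ennreal (?c k)" 1] by (simp add: summableI)
  also have "\<dots> = (\<Sum>k. ennreal (if k = 0 then b else 0) + (\<integral>\<^sup>+t. ennreal (?g k t) \<partial>\<nu>))"
  proof -
    have "ennreal (?c (Suc k)) = ennreal (if k = 0 then b else 0) + (\<integral>\<^sup>+t. ennreal (?g k t) \<partial>\<nu>)" for k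
    proof -
      have nn: "(\<integral>t. t ^ Suc k * exp (- t) \<partial>\<nu>) / fact (Suc k) \<ge> 0"
        using bernstein_repr_space[OF r]
        by (intro divide_nonneg_nonneg integral_nonneg_AE AE_I2) auto
      show ?thesis
        unfolding gi bernstein_coeff_def using nn b
        by (subst ennreal_plus[symmetric]) (auto simp: add.commute simp del: fact_Suc power_Suc)
    qed
    then show ?thesis by simp
  qed
  also have "\<dots> = (\<Sum>k. ennreal (if k = 0 then b else 0)) + (\<Sum>k. \<integral>\<^sup>+t. ennreal (?g k t) \<partial>\<nu>)"
    by (rule suminf_add[symmetric]) (auto intro: summableI)
  also have "(\<Sum>k. ennreal (if k = 0 then b else 0)) = ennreal b"
    using suminf_finite[of "{0}" "\<lambda>k::nat. ennreal (if k = 0 then b else 0)"] by simp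
  also have "(\<Sum>k. \<integral>\<^sup>+t. ennreal (?g k t) \<partial>\<nu>) = (\<integral>\<^sup>+t. (\<Sum>k. ennreal (?g k t)) \<partial>\<nu>)"
    using gm by (rule nn_integral_suminf[symmetric])
  also have "\<dots> = (\<integral>\<^sup>+t. ennreal (1 - exp (- t)) \<partial>\<nu>)"
    by (rule nn_integral_cong) (rule gsum)
  also have "\<dots> = ennreal (\<integral>t. (1 - exp (- t)) \<partial>\<nu>)"
    using ei pos1 by (rule nn_integral_eq_integral)
  also have "ennreal b + \<dots> = ennreal 1"
    using b nn1 tot by (simp only: ennreal_plus[symmetric])
  finally show "(\<integral>\<^sup>+k. ennreal (?c k) \<partial>count_space UNIV) = 1" by simp
qed

end

theory Submission
  imports Defs "HOL-Real_Asymp.Real_Asymp"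
begin

text \<open>
  Let \<open>\<phi>\<close> be the characteristic function of \<open>p\<close> and \<open>\<Phi> = 1 - \<psi>(1 - \<phi>)\<close> that of \<open>S\<^sup>\<psi>\<close>, and let \<open>r\<^sub>n\<close> solve
  \<open>n \<psi>(r\<^sub>n\<^sup>2) = 1\<close>. Fourier inversion and the substitution \<open>\<theta> = r\<^sub>n u\<close> give
  \<open>(2\<pi>)\<^sup>d r\<^sub>n\<^sup>-\<^sup>d p\<^sub>\<psi>(x,n) = \<integral> \<Phi>(r\<^sub>n u)\<^sup>n exp(-i r\<^sub>n x \<cdot> u) du\<close>. Pointwise
  \<open>\<Phi>(r\<^sub>n u)\<^sup>n\<close> tends to \<open>exp(-(\<langle>Qu,u\<rangle>/2)\<^sup>\<alpha>\<^sup>/\<^sup>2)\<close> by regular variation, and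
  \<open>|\<Phi>(\<theta>)| \<le> exp(-c \<psi>(|\<theta>|\<^sup>2))\<close> together with a Potter-type bound for \<open>\<psi>\<close> dominates the
  integrands. Concavity of \<open>\<psi>\<close> turns \<open>n \<psi>(\<parallel>x\<parallel>\<^sup>-\<^sup>2) \<longlonglongrightarrow> \<infinity>\<close> into \<open>r\<^sub>n x \<longlonglongrightarrow> 0\<close>, so the factor
  \<open>exp(-i r\<^sub>n x \<cdot> u)\<close> disappears and \<open>p\<^sub>\<psi>(x,n)\<close>, \<open>p\<^sub>\<psi>(0,n)\<close> have the same asymptotics.
\<close>

section \<open>Fourier inversion on the lattice\<close>

lemma integral_cis_period:
  "(\<integral>t. indicator {-pi..pi} t *\<^sub>R cis (real_of_int m * t) \<partial>lborel) = (if m = 0 then of_real (2 * pi) else 0)"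
proof (cases "m = 0")
  case True
  then show ?thesis by (simp add: scaleR_conv_of_real)
next
  case False
  let ?F = "\<lambda>t. cis (real_of_int m * t) / (\<i> * of_int m)"
  have D: "(?F has_vector_derivative cis (real_of_int m * t)) (at t within {-pi..pi})" for t
  proof -
    have "((\<lambda>z. exp (\<i> * of_int m * z) / (\<i> * of_int m)) has_field_derivative exp (\<i> * of_int m * of_real t)) (at (of_real t))"
      using False by (auto intro!: derivative_eq_intros)
    from has_vector_derivative_real_field[OF this, of "{-pi..pi}"]
    show ?thesis by (simp add: cis_conv_exp mult_ac)
  qed
  have "(\<integral>t. indicator {-pi..pi} t *\<^sub>R cis (real_of_int m * t) \<partial>lborel) = ?F pi - ?F (- pi)"
    by (rule integral_FTC_Icc) (use D in \<open>auto intro!: continuous_intros\<close>)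
  also have "cis (real_of_int m * pi) = cis (real_of_int m * - pi)"
    by (simp add: complex_eq_iff sin_times_pi_eq_0)
  finally show ?thesis using False by simp
qed

lemma integral_lborel_prod:
  fixes f :: "'a::euclidean_space \<Rightarrow> real \<Rightarrow> complex"
  assumes f: "\<And>b. b \<in> Basis \<Longrightarrow> integrable lborel (f b)"
  shows "(\<integral>x. (\<Prod>b\<in>Basis. f b (x \<bullet> b)) \<partial>lborel) = (\<Prod>b\<in>Basis. \<integral>t. f b t \<partial>lborel)"
proof -
  interpret product_sigma_finite "\<lambda>_::'a. lborel :: real measure" ..
  have [measurable]: "f b \<in> borel_measurable borel" if "b \<in> Basis" for b
    using borel_measurable_integrable[OF f[OF that]] by simp
  have "(\<integral>x. (\<Prod>b\<in>Basis. f b (x \<bullet> b)) \<partial>lborel) =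
    (\<integral>x. (\<Prod>b\<in>Basis. f b (x b)) \<partial>(\<Pi>\<^sub>M b\<in>Basis. lborel))"
    by (subst lborel_eq, subst integral_distr) auto
  also have "\<dots> = (\<Prod>b\<in>Basis. \<integral>t. f b t \<partial>lborel)"
    by (rule product_integral_prod) (auto intro: f)
  finally show ?thesis .
qed

definition torus_cube :: "(real ^ 'd) set" where
  "torus_cube = cbox (\<chi> i. - pi) (\<chi> i. pi)"

lemma mem_torus_cube: "\<theta> \<in> torus_cube \<longleftrightarrow> (\<forall>i. \<bar>\<theta> $ i\<bar> \<le> pi)"
  by (auto simp: torus_cube_def mem_box_cart abs_le_iff) (metis minus_le_iff)+

lemma torus_cube_measurable [measurable]: "torus_cube \<in> sets borel"
  by (simp add: torus_cube_def)

lemma cis_sum: "cis (sum f A) = (\<Prod>a\<in>A. cis (f a))"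
  by (induction A rule: infinite_finite_induct) (auto simp: cis_mult [symmetric])

lemma integral_cis_torus_cube:
  fixes y :: "int ^ 'd"
  shows "(\<integral>\<theta>. indicator torus_cube \<theta> *\<^sub>R cis (real_vec y \<bullet> \<theta>) \<partial>lborel) =
    (if y = 0 then of_real (2 * pi) ^ CARD('d) else 0)"
proof -
  let ?g = "\<lambda>(b::real^'d) t. indicator {-pi..pi} t *\<^sub>R cis ((real_vec y \<bullet> b) * t)"
  have prod_ind: "(\<Prod>b\<in>Basis. indicator {-pi..pi} (\<theta> \<bullet> b)) = (indicator torus_cube \<theta> :: real)" for \<theta> :: "real^'d"
  proof (cases "\<theta> \<in> torus_cube")
    case True
    then have "\<theta> \<bullet> b \<in> {-pi..pi}" if "b \<in> Basis" for b
      using that by (auto simp: mem_torus_cube Basis_vec_def inner_axis abs_le_iff)  (metis minus_le_iff)+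
    then show ?thesis using True by simp
  next
    case False
    then obtain i where "\<not> \<bar>\<theta> $ i\<bar> \<le> pi" by (auto simp: mem_torus_cube)
    then have "\<exists>b\<in>Basis. \<theta> \<bullet> b \<notin> {-pi..pi}"
      by (intro bexI[of _ "axis i 1"]) (auto simp: inner_axis axis_in_Basis_iff)
    then show ?thesis using False by (subst prod_zero) (auto simp: indicator_def)
  qed
  have *: "indicator torus_cube \<theta> *\<^sub>R cis (real_vec y \<bullet> \<theta>) = (\<Prod>b\<in>Basis. ?g b (\<theta> \<bullet> b))" for \<theta> :: "real^'d"
    unfolding euclidean_inner[of "real_vec y" \<theta>] cis_sum scaleR_conv_of_real prod.distrib of_real_prod[symmetric] prod_ind ..
  have "(\<integral>\<theta>. indicator torus_cube \<theta> *\<^sub>R cis (real_vec y \<bullet> \<theta>) \<partial>lborel) =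
     (\<Prod>b\<in>Basis. \<integral>t. ?g b t \<partial>lborel)"
    unfolding * by (rule integral_lborel_prod) (auto intro!: borel_integrable_compact continuous_intros)
  also have "\<dots> = (\<Prod>i\<in>UNIV. \<integral>t. ?g (axis i 1) t \<partial>lborel)"
  proof -
    have "bij_betw (\<lambda>i. axis i 1) UNIV (Basis :: (real ^ 'd) set)"
      by (auto simp: Basis_vec_def bij_betw_def inj_on_def axis_eq_axis)
    from prod.reindex_bij_betw[OF this, of "\<lambda>b. \<integral>t. ?g b t \<partial>lborel"]
    show ?thesis by (rule sym)
  qed
  also have "\<dots> = (\<Prod>i\<in>UNIV. if y $ i = 0 then of_real (2 * pi) else 0)"
  proof (rule prod.cong[OF refl])
    fix i
    show "(\<integral>t. ?g (axis i 1) t \<partial>lborel) = (if y $ i = 0 then of_real (2 * pi) else 0)"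
      using integral_cis_period[of "y $ i"] by (simp add: inner_axis real_vec_def)
  qed
  also have "\<dots> = (if y = 0 then of_real (2 * pi) ^ CARD('d) else 0)"
  proof (cases "y = 0")
    case False
    then obtain i where "y $ i \<noteq> 0" by (auto simp: vec_eq_iff)
    with False show ?thesis by (subst prod_zero) auto
  qed simp
  finally show ?thesis .
qed

lemma integrable_torus_cube:
  fixes f :: "real ^ 'd \<Rightarrow> complex"
  assumes "f \<in> borel_measurable borel" and "\<And>\<theta>. norm (f \<theta>) \<le> B"
  shows "integrable lborel (\<lambda>\<theta>. indicator torus_cube \<theta> *\<^sub>R f \<theta>)"
proof (rule integrableI_bounded_set_indicator)
  show "emeasure lborel (torus_cube :: (real^'d) set) < \<infinity>"
    using emeasure_lborel_cbox_finite[of "\<chi> i. - pi" "\<chi> i. pi"] by (simp add: torus_cube_def)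
qed (use assms in auto)

definition char_fun :: "(int ^ 'd) pmf \<Rightarrow> real ^ 'd \<Rightarrow> complex" where
  "char_fun p \<theta> = (\<Sum>v\<in>set_pmf p. pmf p v *\<^sub>R cis (real_vec v \<bullet> \<theta>))"

lemma char_fun_measurable [measurable]: "char_fun p \<in> borel_measurable borel"
  unfolding char_fun_def
  by (intro borel_measurable_continuous_onI continuous_intros)

lemma norm_char_fun_le_1: "finite (set_pmf p) \<Longrightarrow> norm (char_fun p \<theta>) \<le> 1"
  unfolding char_fun_def
  by (rule order_trans[OF norm_sum]) (simp add: sum_pmf_eq_1)

lemma real_vec_diff: "real_vec (x - y) = real_vec x - real_vec y"
  by (simp add: real_vec_def vec_eq_iff)

lemma real_vec_add: "real_vec (x + y) = real_vec x + real_vec y"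
  by (simp add: real_vec_def vec_eq_iff)

lemma real_vec_zero: "real_vec 0 = 0"
  by (simp add: real_vec_def vec_eq_iff)

lemma pmf_map_translate:
  fixes q :: "'a::ab_group_add pmf"
  shows "pmf (map_pmf (\<lambda>s. s + v) q) x = pmf q (x - v)"
  using pmf_map_inj'[of "\<lambda>s. s + v" q "x - v"] by (simp add: inj_def)

lemma pmf_conv_power_Suc:
  fixes p :: "'a::ab_group_add pmf"
  assumes "finite (set_pmf p)"
  shows "pmf (conv_power p (Suc k)) x = (\<Sum>v\<in>set_pmf p. pmf p v * pmf (conv_power p k) (x - v))"
proof -
  have "conv_power p (Suc k) = bind_pmf p (\<lambda>v. map_pmf (\<lambda>s. s + v) (conv_power p k))"
    unfolding conv_power.simps map_pmf_def by (rule bind_commute_pmf)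
  then have "pmf (conv_power p (Suc k)) x = (\<integral>v. pmf (conv_power p k) (x - v) \<partial>p)"
    by (simp only: pmf_bind pmf_map_translate)
  also have "\<dots> = (\<Sum>v\<in>set_pmf p. pmf p v * pmf (conv_power p k) (x - v))"
    using assms by (subst integral_measure_pmf[of "set_pmf p"]) auto
  finally show ?thesis .
qed

lemma fourier_conv_power:
  fixes p :: "(int ^ 'd) pmf"
  assumes fin: "finite (set_pmf p)"
  shows "(\<integral>\<theta>. indicator torus_cube \<theta> *\<^sub>R (char_fun p \<theta> ^ k * cis (- (real_vec x \<bullet> \<theta>))) \<partial>lborel) =
     of_real ((2 * pi) ^ CARD('d) * pmf (conv_power p k) x)"
proof (induction k arbitrary: x)
  case 0
  show ?case
    using integral_cis_torus_cube[of "- x"]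
    by (auto simp: real_vec_def inner_vec_def sum_negf indicator_def)
next
  case (Suc k)
  let ?I = "\<lambda>x \<theta>. indicator torus_cube \<theta> *\<^sub>R (char_fun p \<theta> ^ k * cis (- (real_vec x \<bullet> \<theta>)))"
  have int: "integrable lborel (?I x)" for x
    using fin by (intro integrable_torus_cube[where B=1])
       (auto simp: norm_mult norm_power intro!: power_le_one norm_char_fun_le_1 borel_measurable_continuous_onI[of "\<lambda>\<theta>. cis (- (real_vec x \<bullet> \<theta>))"] continuous_intros borel_measurable_times borel_measurable_power char_fun_measurable)
  have "indicator torus_cube \<theta> *\<^sub>R (char_fun p \<theta> ^ Suc k * cis (- (real_vec x \<bullet> \<theta>))) =
     (\<Sum>v\<in>set_pmf p. pmf p v *\<^sub>R ?I (x - v) \<theta>)" for \<theta>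
  proof -
    have "cis (real_vec v \<bullet> \<theta>) * cis (- (real_vec x \<bullet> \<theta>)) = cis (- (real_vec (x - v) \<bullet> \<theta>))" for v
      by (simp add: cis_mult real_vec_diff inner_diff_left)
    note [simp] = this[symmetric]
    have "char_fun p \<theta> ^ Suc k = (\<Sum>v\<in>set_pmf p. pmf p v *\<^sub>R cis (real_vec v \<bullet> \<theta>)) * char_fun p \<theta> ^ k"
      by (simp add: char_fun_def)
    then show ?thesis by (simp add: sum_distrib_right sum_distrib_left scaleR_sum_right mult_ac)
  qed
  then have "(\<integral>\<theta>. indicator torus_cube \<theta> *\<^sub>R (char_fun p \<theta> ^ Suc k * cis (- (real_vec x \<bullet> \<theta>))) \<partial>lborel) =
    (\<Sum>v\<in>set_pmf p. pmf p v *\<^sub>R of_real ((2 * pi) ^ CARD('d) * pmf (conv_power p k) (x - v)))"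
    by (simp only: Suc.IH[symmetric] Bochner_Integration.integral_sum[OF integrable_scaleR_right[OF int]] integral_scaleR_right)
  also have "\<dots> = of_real ((2 * pi) ^ CARD('d) * pmf (conv_power p (Suc k)) x)"
    by (simp only: pmf_conv_power_Suc[OF fin]) (simp add: scaleR_conv_of_real sum_distrib_left mult_ac)
  finally show ?case .
qed

definition pgf :: "nat pmf \<Rightarrow> complex \<Rightarrow> complex" where
  "pgf q z = (\<Sum>k. pmf q k *\<^sub>R z ^ k)"

lemma pmf_nat_sums_1: "pmf q sums (1::real)" for q :: "nat pmf"
proof -
  have "integrable (count_space UNIV) (pmf q)" by (rule integrable_pmf)
  from sums_integral_count_space_nat[OF this] show ?thesis
    by (simp add: integral_pmf)
qed

lemma integral_pmf_nat_sums:
  fixes f :: "nat \<Rightarrow> real"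
  assumes "\<And>k. \<bar>f k\<bar> \<le> B"
  shows "(\<lambda>k. pmf q k * f k) sums (\<integral>k. f k \<partial>measure_pmf q)"
proof -
  have "integrable (measure_pmf q) f"
    by (rule measure_pmf.integrable_const_bound[where B=B]) (use assms in auto)
  then have "integrable (count_space UNIV) (\<lambda>k. pmf q k * f k)"
    by (simp add: measure_pmf_eq_density integrable_density)
  from sums_integral_count_space_nat[OF this] show ?thesis
    by (simp add: measure_pmf_eq_density integral_density)
qed

lemma norm_power_le_1: "norm z \<le> 1 \<Longrightarrow> norm (z ^ k :: complex) \<le> 1"
  by (simp add: norm_power power_le_one)

lemma summable_norm_pgf:
  assumes "norm z \<le> 1"
  shows "summable (\<lambda>k. norm (pmf q k *\<^sub>R (z::complex) ^ k))"
proof (rule summable_comparison_test'[of "pmf q"])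
  show "summable (pmf q)" using pmf_nat_sums_1 by (rule sums_summable)
  show "norm (norm (pmf q k *\<^sub>R z ^ k)) \<le> pmf q k" if "k \<ge> 0" for k
    using norm_power_le_1[OF assms, of k] by (simp add: mult_left_le)
qed

lemma pgf_sums:
  assumes "norm z \<le> 1"
  shows "(\<lambda>k. pmf q k *\<^sub>R z ^ k) sums pgf q z"
  unfolding pgf_def using summable_norm_cancel[OF summable_norm_pgf[OF assms]] by (rule summable_sums)

lemma pmf_nat_conv_power_Suc:
  fixes q :: "nat pmf"
  shows "pmf (conv_power q (Suc n)) m = (\<Sum>i\<le>m. pmf (conv_power q n) i * pmf q (m - i))"
proof -
  have *: "pmf (map_pmf (\<lambda>v. s + v) q) m = (if s \<le> m then pmf q (m - s) else 0)" for s
  proof (cases "s \<le> m")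
    case True
    then show ?thesis using pmf_map_inj'[of "\<lambda>v. s + v" q "m - s"] by (simp add: inj_def)
  next
    case False
    then show ?thesis by (auto simp: pmf_eq_0_set_pmf)
  qed
  have "pmf (conv_power q (Suc n)) m = (\<integral>s. (if s \<le> m then pmf q (m - s) else 0) \<partial>conv_power q n)"
    by (simp add: pmf_bind *)
  also have "\<dots> = (\<Sum>i\<le>m. pmf (conv_power q n) i * pmf q (m - i))"
    by (subst integral_measure_pmf[of "{..m}"]) (auto split: if_splits)
  finally show ?thesis .
qed

lemma pgf_conv_power:
  assumes z: "norm z \<le> 1"
  shows "pgf (conv_power q n) z = pgf q z ^ n"
proof (induction n)
  case 0
  have "pgf (conv_power q 0) z = (\<Sum>k\<in>{0}. pmf (conv_power q 0) k *\<^sub>R z ^ k)"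
    unfolding pgf_def by (rule suminf_finite) (auto simp: indicator_def)
  then show ?case by simp
next
  case (Suc n)
  have "pgf (conv_power q n) z * pgf q z =
    (\<Sum>k. \<Sum>i\<le>k. (pmf (conv_power q n) i *\<^sub>R z ^ i) * (pmf q (k - i) *\<^sub>R z ^ (k - i)))"
    unfolding pgf_def by (intro Cauchy_product summable_norm_pgf z)
  also have "\<dots> = (\<Sum>k. pmf (conv_power q (Suc n)) k *\<^sub>R z ^ k)"
  proof (rule suminf_cong)
    fix k
    show "(\<Sum>i\<le>k. (pmf (conv_power q n) i *\<^sub>R z ^ i) * (pmf q (k - i) *\<^sub>R z ^ (k - i))) =
      pmf (conv_power q (Suc n)) k *\<^sub>R z ^ k"
      unfolding pmf_nat_conv_power_Suc scaleR_sum_left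
      by (rule sum.cong) (auto simp: power_add[symmetric])
  qed
  finally show ?case using Suc.IH by (simp add: pgf_def mult.commute del: conv_power.simps)
qed

lemma borel_measurable_pgf_char_fun [measurable]:
  fixes p :: "(int ^ 'd) pmf"
  shows "(\<lambda>\<theta>. pgf q (char_fun p \<theta>)) \<in> borel_measurable borel"
  unfolding pgf_def by measurable

lemma borel_measurable_cis_inner [measurable]:
  "(\<lambda>\<theta>::real^'d. cis (- (v \<bullet> \<theta>))) \<in> borel_measurable borel"
  by (intro borel_measurable_continuous_onI continuous_intros)

lemma fourier_random_time:
  fixes p :: "(int ^ 'd) pmf"
  assumes fin: "finite (set_pmf p)"
  shows "(\<integral>\<theta>. indicator torus_cube \<theta> *\<^sub>R (pgf q (char_fun p \<theta>) ^ n * cis (- (real_vec x \<bullet> \<theta>))) \<partial>lborel) =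
     of_real ((2 * pi) ^ CARD('d) * pmf (bind_pmf (conv_power q n) (conv_power p)) x)"
proof -
  let ?T = "conv_power q n"
  let ?I = "\<lambda>k \<theta>. indicator torus_cube \<theta> *\<^sub>R (char_fun p \<theta> ^ k * cis (- (real_vec x \<bullet> \<theta>)))"
  note z = norm_char_fun_le_1[OF fin]
  have nI: "norm (?I k \<theta>) \<le> indicator torus_cube \<theta>" for k \<theta>
    using norm_power_le_1[OF z, of \<theta> k] by (simp add: norm_mult indicator_def)
  have int: "integrable lborel (?I k)" for k
    using norm_power_le_1[OF z] by (intro integrable_torus_cube[where B=1]) (auto simp: norm_mult)
  have sumI: "(\<lambda>k. pmf ?T k *\<^sub>R ?I k \<theta>) sums
      (indicator torus_cube \<theta> *\<^sub>R (pgf q (char_fun p \<theta>) ^ n * cis (- (real_vec x \<bullet> \<theta>))))" for \<theta>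
    using sums_mult2[OF pgf_sums[OF z, of ?T \<theta>], of "indicator torus_cube \<theta> *\<^sub>R cis (- (real_vec x \<bullet> \<theta>))"]
    by (simp add: pgf_conv_power[OF z] mult.commute[of "indicator torus_cube \<theta>"])
  have "(\<lambda>k. \<integral>\<theta>. pmf ?T k *\<^sub>R ?I k \<theta> \<partial>lborel) sums (\<integral>\<theta>. (\<Sum>k. pmf ?T k *\<^sub>R ?I k \<theta>) \<partial>lborel)"
  proof (rule sums_integral)
    show "integrable lborel (\<lambda>\<theta>. pmf ?T k *\<^sub>R ?I k \<theta>)" for k using int by (rule integrable_scaleR_right)
    show "AE \<theta> in lborel. summable (\<lambda>k. norm (pmf ?T k *\<^sub>R ?I k \<theta>))"
    proof (rule AE_I2, rule summable_comparison_test'[of "pmf ?T"])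
      show "summable (pmf ?T)" using pmf_nat_sums_1 by (rule sums_summable)
      show "norm (norm (pmf ?T k *\<^sub>R ?I k \<theta>)) \<le> pmf ?T k" if "k \<ge> 0" for k \<theta>
        using order_trans[OF nI[of \<theta> k], of 1] by (simp add: mult.assoc mult_left_le indicator_le_1)
    qed
    let ?V = "\<integral>\<theta>. indicator (torus_cube :: (real^'d) set) \<theta> \<partial>lborel :: real"
    have iV: "integrable lborel (indicator (torus_cube :: (real^'d) set) :: _ \<Rightarrow> real)"
      using emeasure_lborel_cbox_finite[of "\<chi> i. - pi" "\<chi> i::'d. pi"]
      by (intro integrable_real_indicator) (auto simp: torus_cube_def)
    show "summable (\<lambda>k. \<integral>\<theta>. norm (pmf ?T k *\<^sub>R ?I k \<theta>) \<partial>lborel)"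
    proof (rule summable_comparison_test'[of "\<lambda>k. pmf ?T k * ?V"])
      show "summable (\<lambda>k. pmf ?T k * ?V)"
        using pmf_nat_sums_1 by (intro summable_mult2) (rule sums_summable)
      fix k
      have "(\<integral>\<theta>. norm (pmf ?T k *\<^sub>R ?I k \<theta>) \<partial>lborel) \<le> (\<integral>\<theta>. pmf ?T k * indicator (torus_cube :: (real^'d) set) \<theta> \<partial>lborel)"
        using int iV nI
        by (intro integral_mono integrable_norm integrable_scaleR_right integrable_mult_right)
          (auto simp: mult.assoc mult_left_mono simp del: norm_mult)
      then show "norm (\<integral>\<theta>. norm (pmf ?T k *\<^sub>R ?I k \<theta>) \<partial>lborel) \<le> pmf ?T k * ?V"
        by simp
    qed
  qed
  also have "(\<lambda>\<theta>. \<Sum>k. pmf ?T k *\<^sub>R ?I k \<theta>) =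
     (\<lambda>\<theta>. indicator torus_cube \<theta> *\<^sub>R (pgf q (char_fun p \<theta>) ^ n * cis (- (real_vec x \<bullet> \<theta>))))"
    using sums_unique[OF sumI] by (simp add: fun_eq_iff)
  also have "(\<lambda>k. \<integral>\<theta>. pmf ?T k *\<^sub>R ?I k \<theta> \<partial>lborel) =
     (\<lambda>k. of_real ((2 * pi) ^ CARD('d) * (pmf ?T k * pmf (conv_power p k) x)))"
    by (simp only: integral_scaleR_right fourier_conv_power[OF fin]) (simp add: scaleR_conv_of_real mult_ac)
  finally have 1: "(\<lambda>k. complex_of_real ((2 * pi) ^ CARD('d) * (pmf ?T k * pmf (conv_power p k) x))) sums
    (\<integral>\<theta>. indicator torus_cube \<theta> *\<^sub>R (pgf q (char_fun p \<theta>) ^ n * cis (- (real_vec x \<bullet> \<theta>))) \<partial>lborel)" .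
  have "(\<lambda>k. pmf ?T k * pmf (conv_power p k) x) sums pmf (bind_pmf ?T (conv_power p)) x"
    unfolding pmf_bind by (rule integral_pmf_nat_sums[where B=1]) (simp add: pmf_le_1)
  from sums_of_real[OF sums_mult[OF this, of "(2 * pi) ^ CARD('d)"]] 1
  show ?thesis by (rule sums_unique2[symmetric])
qed

section \<open>Generating functions of random times\<close>

lemma norm_pgf_le:
  assumes "norm z \<le> 1" and S: "(\<lambda>k. pmf q k * norm z ^ k) sums S"
  shows "norm (pgf q z) \<le> S"
proof (rule norm_sums_le[OF pgf_sums[OF assms(1), of q] S])
  show "norm (pmf q k *\<^sub>R z ^ k) \<le> pmf q k * norm z ^ k" for k by (simp add: norm_power)
qed

lemma norm_linear_combination_le:
  fixes z :: complex and s t :: real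
  assumes "s > 0" "t > 0" "norm z \<le> 1"
  shows "norm (of_real s + of_real t * z) \<le> s + t - s * t / (s + t) * (1 - Re z)"
proof (rule power2_le_imp_le)
  have Re: "\<bar>Re z\<bar> \<le> 1" using abs_Re_le_cmod[of z] assms by linarith
  have "s * t / (s + t) * (1 - Re z) \<le> s * t / (s + t) * 2"
    using assms Re by (intro mult_left_mono) auto
  also have "\<dots> \<le> s + t"
  proof -
    have "0 \<le> s\<^sup>2 + t\<^sup>2" by simp
    then show ?thesis using assms by (simp add: field_simps power2_eq_square)
  qed
  finally show "0 \<le> s + t - s * t / (s + t) * (1 - Re z)" by simp
  have n2: "(Re z)\<^sup>2 + (Im z)\<^sup>2 \<le> 1"
    using power_mono[OF assms(3) norm_ge_zero, of 2] by (simp add: cmod_power2)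
  have "(norm (of_real s + of_real t * z))\<^sup>2 = s\<^sup>2 + 2 * s * t * Re z + t\<^sup>2 * ((Re z)\<^sup>2 + (Im z)\<^sup>2)"
    unfolding cmod_power2 by (simp add: power2_eq_square algebra_simps)
  also have "\<dots> \<le> s\<^sup>2 + 2 * s * t * Re z + t\<^sup>2 * 1"
    using n2 by (intro add_left_mono mult_left_mono) auto
  also have "\<dots> = (s + t)\<^sup>2 - 2 * (s + t) * (s * t / (s + t) * (1 - Re z))"
    using assms by (simp add: power2_eq_square field_simps)
  also have "\<dots> \<le> (s + t - s * t / (s + t) * (1 - Re z))\<^sup>2"
    by (simp add: power2_diff)
  finally show "(norm (of_real s + of_real t * z))\<^sup>2 \<le> (s + t - s * t / (s + t) * (1 - Re z))\<^sup>2" .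
qed

text \<open>Mass at the two consecutive times 1 and 2 is what makes the subordinate walk aperiodic.\<close>

lemma norm_pgf_le_Re:
  assumes pos: "pmf q 1 > 0" "pmf q 2 > 0"
  obtains c where "c > 0" "\<And>z. norm z \<le> 1 \<Longrightarrow> norm (pgf q z) \<le> 1 - c * (1 - Re z)"
proof
  let ?c = "pmf q 1 * pmf q 2 / (pmf q 1 + pmf q 2)"
  show "?c > 0" using pos by simp
  fix z :: complex assume z: "norm z \<le> 1"
  have f: "(\<lambda>k. if k \<in> {1, 2} then pmf q k *\<^sub>R z ^ k else 0) sums (\<Sum>k\<in>{1, 2}. pmf q k *\<^sub>R z ^ k)"
    and g: "(\<lambda>k. if k \<in> {1, 2} then pmf q k else 0) sums (\<Sum>k\<in>{1, 2}. pmf q k)"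
    by (rule sums_If_finite_set, simp)+
  have "norm (pgf q z - (\<Sum>k\<in>{1, 2}. pmf q k *\<^sub>R z ^ k)) \<le> 1 - (\<Sum>k\<in>{1, 2}. pmf q k)"
  proof (rule norm_sums_le[OF sums_diff[OF pgf_sums[OF z, of q] f] sums_diff[OF pmf_nat_sums_1[of q] g]])
    fix k
    show "norm (pmf q k *\<^sub>R z ^ k - (if k \<in> {1, 2} then pmf q k *\<^sub>R z ^ k else 0))
      \<le> pmf q k - (if k \<in> {1, 2} then pmf q k else 0)"
      using norm_power_le_1[OF z, of k] by (auto intro: mult_left_le)
  qed
  then have "norm (pgf q z) \<le> norm (\<Sum>k\<in>{1, 2}. pmf q k *\<^sub>R z ^ k) + (1 - (\<Sum>k\<in>{1, 2}. pmf q k))"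
    using norm_triangle_sub[of "pgf q z"] by (smt (verit))
  also have "(\<Sum>k\<in>{1, 2}. pmf q k *\<^sub>R z ^ k) = z * (of_real (pmf q 1) + of_real (pmf q 2) * z)"
    by (simp add: scaleR_conv_of_real power2_eq_square algebra_simps)
  also have "norm \<dots> \<le> norm (of_real (pmf q 1) + of_real (pmf q 2) * z)"
    using z by (simp add: norm_mult mult_left_le_one_le)
  also have "\<dots> \<le> pmf q 1 + pmf q 2 - ?c * (1 - Re z)"
    using pos z by (rule norm_linear_combination_le)
  finally show "norm (pgf q z) \<le> 1 - ?c * (1 - Re z)" by simp
qed

lemma norm_power_diff_le:
  fixes z w :: complex
  assumes "norm z \<le> m" "norm w \<le> m" "0 \<le> m" "m < 1"
  shows "norm (z ^ k - w ^ k) \<le> norm (z - w) / (1 - m) * (1 - m ^ k)"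
proof -
  have "norm (z ^ k - w ^ k) = norm (z - w) * norm (\<Sum>i<k. w ^ (k - Suc i) * z ^ i)"
    by (simp only: power_diff_sumr2[of z k w] norm_mult)
  also have "norm (\<Sum>i<k. w ^ (k - Suc i) * z ^ i) \<le> (\<Sum>i<k. m ^ i)"
  proof (rule order_trans[OF norm_sum], rule sum_mono)
    fix i assume i: "i \<in> {..<k}"
    have "norm (w ^ (k - Suc i) * z ^ i) \<le> m ^ (k - Suc i) * m ^ i"
      unfolding norm_mult norm_power using assms by (intro mult_mono power_mono) auto
    also have "\<dots> \<le> 1 * m ^ i"
      using assms by (intro mult_right_mono power_le_one) auto
    finally show "norm (w ^ (k - Suc i) * z ^ i) \<le> m ^ i" by simp
  qed
  also have "(\<Sum>i<k. m ^ i) = (1 - m ^ k) / (1 - m)"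
    using assms by (simp add: sum_gp_strict)
  finally show ?thesis by (simp add: mult_left_mono)
qed

lemma norm_pgf_diff_le:
  assumes "norm z \<le> m" "norm w \<le> m" "0 \<le> m" "m < 1" and S: "(\<lambda>k. pmf q k * m ^ k) sums S"
  shows "norm (pgf q z - pgf q w) \<le> norm (z - w) / (1 - m) * (1 - S)"
proof (rule norm_sums_le[OF sums_diff[OF pgf_sums pgf_sums] sums_mult[OF sums_diff[OF pmf_nat_sums_1 S]]])
  show "norm (pmf q k *\<^sub>R z ^ k - pmf q k *\<^sub>R w ^ k) \<le> norm (z - w) / (1 - m) * (pmf q k - pmf q k * m ^ k)" for k
  proof -
    have "norm (pmf q k *\<^sub>R z ^ k - pmf q k *\<^sub>R w ^ k) = pmf q k * norm (z ^ k - w ^ k)"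
      by (simp add: scaleR_diff_right[symmetric])
    also have "\<dots> \<le> pmf q k * (norm (z - w) / (1 - m) * (1 - m ^ k))"
      using norm_power_diff_le[OF assms(1-4), of k] by (intro mult_left_mono) auto
    also have "\<dots> = norm (z - w) / (1 - m) * (pmf q k - pmf q k * m ^ k)"
      by (simp add: right_diff_distrib diff_divide_distrib mult_ac)
    finally show ?thesis .
  qed
qed (use assms in auto)

section \<open>Bernstein functions\<close>

lemma one_minus_exp_mult_le:
  fixes y :: real
  assumes "c \<ge> 1"
  shows "1 - exp (- (c * y)) \<le> c * (1 - exp (- y))"
proof -
  have "exp ((1 - 1 / c) *\<^sub>R 0 + (1 / c) *\<^sub>R (- (c * y))) \<le> (1 - 1 / c) * exp 0 + (1 / c) * exp (- (c * y))"
    using assms by (intro convex_onD[OF exp_convex]) (auto simp: field_simps)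
  then have "c * exp (- y) \<le> c * ((1 - 1 / c) + (1 / c) * exp (- (c * y)))"
    using assms by (intro mult_left_mono) auto
  also have "\<dots> = c - 1 + exp (- (c * y))" using assms by (simp add: field_simps)
  finally show ?thesis by (simp add: algebra_simps)
qed

locale bernstein_representation =
  fixes \<psi> :: "real \<Rightarrow> real" and a b :: real and \<nu> :: "real measure"
  assumes repr: "bernstein_repr \<psi> a b \<nu>" and psi_continuous: "continuous_on {0..} \<psi>"
    and psi_0: "\<psi> 0 = 0" and psi_1: "\<psi> 1 = 1"
begin

lemma drift_nonneg: "b \<ge> 0"
  using repr by (simp add: bernstein_repr_def)

lemma in_space_nonneg: "t \<in> space \<nu> \<Longrightarrow> t \<ge> 0"
  using bernstein_repr_space[OF repr] by simp

lemma integrable_one_minus_exp: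
  assumes x: "x \<ge> 0"
  shows "integrable \<nu> (\<lambda>s. 1 - exp (- x * s))"
proof (rule Bochner_Integration.integrable_bound)
  show "integrable \<nu> (\<lambda>s. (1 + x) * min 1 s)" using repr by (simp add: bernstein_repr_def)
  show "(\<lambda>s. 1 - exp (- x * s)) \<in> borel_measurable \<nu>"
    by (rule bernstein_repr_measurable[OF repr]) simp
  show "AE s in \<nu>. norm (1 - exp (- x * s)) \<le> norm ((1 + x) * min 1 s)"
  proof (rule AE_I2)
    fix s assume "s \<in> space \<nu>"
    then have s: "s \<ge> 0" by (rule in_space_nonneg)
    have "0 \<le> 1 - exp (- x * s)" using x s by simp
    moreover have "1 - exp (- x * s) \<le> (1 + x) * min 1 s"
    proof (cases "s \<le> 1")
      case True
      have "1 - exp (- x * s) \<le> x * s" using exp_ge_add_one_self[of "- x * s"] by simp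
      with True s show ?thesis by (simp add: algebra_simps)
    next
      case False
      have "exp (- x * s) > 0" by simp
      with False x have "1 - exp (- x * s) \<le> 1 + x" by linarith
      with False show ?thesis by simp
    qed
    ultimately show "norm (1 - exp (- x * s)) \<le> norm ((1 + x) * min 1 s)" by simp
  qed
qed

lemma psi_eq: "x \<ge> 0 \<Longrightarrow> \<psi> x = b * x + (\<integral>s. (1 - exp (- x * s)) \<partial>\<nu>)"
  using repr psi_0 by (auto simp: bernstein_repr_def)

lemma psi_mono:
  assumes "0 \<le> x" "x \<le> y"
  shows "\<psi> x \<le> \<psi> y"
proof -
  have "(\<integral>s. (1 - exp (- x * s)) \<partial>\<nu>) \<le> (\<integral>s. (1 - exp (- y * s)) \<partial>\<nu>)"
    using assms by (intro integral_mono integrable_one_minus_exp) (auto intro: mult_right_mono in_space_nonneg)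
  then show ?thesis
    using assms drift_nonneg by (auto simp: psi_eq intro!: add_mono mult_left_mono)
qed

lemma psi_mult_le:
  assumes "c \<ge> 1" "x \<ge> 0"
  shows "\<psi> (c * x) \<le> c * \<psi> x"
proof -
  have "(\<integral>s. (1 - exp (- (c * x) * s)) \<partial>\<nu>) \<le> (\<integral>s. c * (1 - exp (- x * s)) \<partial>\<nu>)"
    using assms one_minus_exp_mult_le[OF assms(1), of "x * s" for s]
    by (intro integral_mono integrable_one_minus_exp integrable_mult_right) (auto simp: mult_ac)
  also have "\<dots> = c * (\<integral>s. (1 - exp (- x * s)) \<partial>\<nu>)" by simp
  finally show ?thesis
    using assms by (simp add: psi_eq algebra_simps)
qed

lemma psi_nonneg: "x \<ge> 0 \<Longrightarrow> \<psi> x \<ge> 0"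
  using psi_mono[of 0 x] by (simp add: psi_0)

lemma psi_pos:
  assumes "x > 0"
  shows "\<psi> x > 0"
proof (cases "x \<ge> 1")
  case True
  then show ?thesis using psi_mono[of 1 x] by (simp add: psi_1)
next
  case False
  then have "1 \<le> (1 / x) * \<psi> x" using psi_mult_le[of "1 / x" x] assms by (simp add: psi_1)
  then show ?thesis using assms by (simp add: field_simps)
qed

lemma subordinator_step_sums:
  assumes s: "0 \<le> s" "s \<le> 1"
  shows "(\<lambda>k. pmf (subordinator_step b \<nu>) k * s ^ k) sums (1 - \<psi> (1 - s))"
proof -
  let ?R = "subordinator_step b \<nu>"
  let ?g = "\<lambda>k t. t ^ Suc k * exp (- t) / fact (Suc k) * s ^ Suc k :: real"
  have gi: "integrable \<nu> (?g k)" for k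
    using bernstein_coeff_integrable[OF repr, of "Suc k"]
    by (intro integrable_mult_left integrable_divide_zero) simp
  have gn: "0 \<le> ?g k t" if "t \<in> space \<nu>" for k t
    using s in_space_nonneg[OF that] by simp
  have R: "pmf ?R (Suc k) * s ^ Suc k = (\<integral>t. ?g k t \<partial>\<nu>) + (if k = 0 then b * s else 0)" for k
  proof -
    have "(\<integral>t. ?g k t \<partial>\<nu>) = (\<integral>t. t ^ Suc k * exp (- t) \<partial>\<nu>) / fact (Suc k) * s ^ Suc k"
      by (simp only: integral_mult_left_zero integral_divide_zero)
    then show ?thesis
      by (simp add: pmf_subordinator_step[OF repr psi_0 psi_1] bernstein_coeff_def distrib_right
          del: fact_Suc power_Suc)
  qed
  have gs: "(\<lambda>k. ?g k t) sums (exp (- (1 - s) * t) - exp (- t))" for t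
  proof -
    have "(\<lambda>n. (s * t) ^ n / fact n) sums exp (s * t)"
      using exp_converges[of "s * t"] by (simp add: field_simps)
    from sums_mult[OF this, of "exp (- t)"]
    have "(\<lambda>n. exp (- t) * ((s * t) ^ n / fact n)) sums exp (- (1 - s) * t)"
      by (simp add: exp_add[symmetric] algebra_simps)
    then have "(\<lambda>n. exp (- t) * ((s * t) ^ Suc n / fact (Suc n))) sums
        (exp (- (1 - s) * t) - exp (- t) * ((s * t) ^ 0 / fact 0))"
      by (subst sums_Suc_iff) simp
    then show ?thesis by (simp add: mult_ac power_mult_distrib)
  qed
  have "(\<lambda>k. \<integral>t. ?g k t \<partial>\<nu>) sums (\<integral>t. (\<Sum>k. ?g k t) \<partial>\<nu>)"
  proof (rule sums_integral)
    show "integrable \<nu> (?g k)" for k by (rule gi)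
    show "AE t in \<nu>. summable (\<lambda>k. norm (?g k t))"
    proof (rule AE_I2)
      fix t assume "t \<in> space \<nu>"
      then have "norm (?g k t) = ?g k t" for k
        using gn[of t k] by (simp only: real_norm_def abs_of_nonneg)
      then show "summable (\<lambda>k. norm (?g k t))" using sums_summable[OF gs] by (simp only:)
    qed
    have "(\<integral>t. norm (?g k t) \<partial>\<nu>) \<le> pmf ?R (Suc k)" for k
    proof -
      have "(\<integral>t. norm (?g k t) \<partial>\<nu>) = (\<integral>t. ?g k t \<partial>\<nu>)"
        using gn by (intro Bochner_Integration.integral_cong[OF refl]) (simp only: real_norm_def abs_of_nonneg)
      also have "\<dots> \<le> pmf ?R (Suc k) * s ^ Suc k"
        unfolding R using drift_nonneg s by simp
      also have "\<dots> \<le> pmf ?R (Suc k)"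
        using s by (intro mult_left_le power_le_one) auto
      finally show ?thesis .
    qed
    moreover have "summable (\<lambda>k. pmf ?R (Suc k))"
    proof -
      have "integrable (count_space UNIV) (pmf ?R)" by (rule integrable_pmf)
      from sums_summable[OF sums_integral_count_space_nat[OF this]] show ?thesis
        by (subst summable_Suc_iff)
    qed
    ultimately show "summable (\<lambda>k. \<integral>t. norm (?g k t) \<partial>\<nu>)"
      by - (rule summable_comparison_test'[of "\<lambda>k. pmf ?R (Suc k)" 0],
        auto simp del: norm_mult norm_divide power_Suc fact_Suc)
  qed
  also have "(\<lambda>t. \<Sum>k. ?g k t) = (\<lambda>t. (1 - exp (- 1 * t)) - (1 - exp (- (1 - s) * t)))"
    using sums_unique[OF gs] by (simp add: fun_eq_iff)
  also have "(\<integral>t. (1 - exp (- 1 * t)) - (1 - exp (- (1 - s) * t)) \<partial>\<nu>) = 1 - \<psi> (1 - s) - b * s"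
    using s psi_eq[of 1] psi_eq[of "1 - s"] psi_1
    by (subst Bochner_Integration.integral_diff[OF integrable_one_minus_exp[of 1] integrable_one_minus_exp[of "1 - s"]]) (auto simp: algebra_simps)
  finally have 1: "(\<lambda>k. \<integral>t. ?g k t \<partial>\<nu>) sums (1 - \<psi> (1 - s) - b * s)" .
  have "(\<lambda>k. if k = 0 then b * s else 0) sums (b * s)"
    using sums_single[of 0 "\<lambda>_. b * s"] by simp
  from sums_add[OF 1 this] have "(\<lambda>k. pmf ?R (Suc k) * s ^ Suc k) sums (1 - \<psi> (1 - s))"
    by (simp only: R) simp
  then show ?thesis
    using sums_Suc[of "\<lambda>k. pmf ?R k * s ^ k"]
    by (simp add: pmf_subordinator_step[OF repr psi_0 psi_1])
qed

lemma subordinator_step_pos: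
  assumes x: "x \<ge> 0" "\<psi> x \<noteq> x" and k: "k \<ge> 1"
  shows "pmf (subordinator_step b \<nu>) k > 0"
proof (rule ccontr)
  assume "\<not> ?thesis"
  then have "bernstein_coeff b \<nu> k = 0"
    using k pmf_nonneg[of "subordinator_step b \<nu>" k]
    by (simp add: pmf_subordinator_step[OF repr psi_0 psi_1])
  moreover have nn: "AE t in \<nu>. 0 \<le> t ^ k * exp (- t)"
    using in_space_nonneg by (intro AE_I2) auto
  ultimately have "(\<integral>t. t ^ k * exp (- t) \<partial>\<nu>) = 0"
    using drift_nonneg integral_nonneg_AE[OF nn]
    by (simp add: bernstein_coeff_def divide_nonneg_pos add_nonneg_eq_0_iff split: if_splits)
  then have "AE t in \<nu>. t ^ k * exp (- t) = 0"
    using integral_nonneg_eq_0_iff_AE[OF bernstein_coeff_integrable[OF repr k] nn] by simp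
  then have z: "AE t in \<nu>. t = 0" by eventually_elim simp
  have "\<psi> y = b * y" if "y \<ge> 0" for y
  proof -
    have "(\<integral>s. (1 - exp (- y * s)) \<partial>\<nu>) = (\<integral>s. 0 \<partial>\<nu>)"
      using z by (intro integral_cong_AE) (auto intro: bernstein_repr_measurable[OF repr])
    then show ?thesis using psi_eq[OF that] by simp
  qed
  from this[of 1] this[OF x(1)] show False using x psi_1 by simp
qed

end

lemma regularly_varying_ratio:
  assumes rv: "regularly_varying_at_zero \<beta> \<psi>" and c: "c > 0"
  shows "((\<lambda>x. \<psi> (c * x) / \<psi> x) \<longlongrightarrow> c powr \<beta>) (at_right 0)"
proof -
  from rv obtain l where l: "slowly_varying l" and "\<forall>\<^sub>F x in at_right 0. \<psi> x = x powr \<beta> * l (1 / x)"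
    by (auto simp: regularly_varying_at_zero_def)
  then obtain e where e: "e > 0" "\<And>x. 0 < x \<Longrightarrow> x < e \<Longrightarrow> \<psi> x = x powr \<beta> * l (1 / x)"
    by (auto simp: eventually_at_right_field)
  have "((\<lambda>y. l (1 / c * y) / l y) \<longlongrightarrow> 1) at_top"
    using l c unfolding slowly_varying_def by (meson zero_less_divide_1_iff)
  from filterlim_compose[OF this filterlim_inverse_at_top_right]
  have "((\<lambda>x. c powr \<beta> * (l (1 / c * inverse x) / l (inverse x))) \<longlongrightarrow> c powr \<beta> * 1) (at_right 0)"
    by (intro tendsto_mult tendsto_const)
  moreover have "\<forall>\<^sub>F x in at_right 0. c powr \<beta> * (l (1 / c * inverse x) / l (inverse x)) = \<psi> (c * x) / \<psi> x"
    unfolding eventually_at_right_field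
  proof (intro exI[of _ "min e (e / c)"] conjI allI impI)
    show "min e (e / c) > 0" using e c by simp
    fix x assume x: "0 < x" "x < min e (e / c)"
    then have "c * x < e" using c by (simp add: field_simps)
    then show "c powr \<beta> * (l (1 / c * inverse x) / l (inverse x)) = \<psi> (c * x) / \<psi> x"
      using x c e(2)[of x] e(2)[of "c * x"] by (simp add: powr_mult inverse_eq_divide)
  qed
  ultimately show ?thesis by (auto elim: Lim_transform_eventually)
qed

lemma ex_power_4:
  fixes y :: real
  assumes "y \<ge> 1"
  obtains k where "4 ^ k \<le> y" "y < 4 ^ (k + 1)"
proof -
  have "nat \<lfloor>y\<rfloor> \<ge> 1" using assms by (simp add: le_nat_iff le_floor_iff)
  then obtain k where "4 ^ k \<le> nat \<lfloor>y\<rfloor>" "nat \<lfloor>y\<rfloor> < 4 ^ (k + 1)"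
    using ex_power_ivl1[of 4 "nat \<lfloor>y\<rfloor>"] by auto
  then have "real (4 ^ k) \<le> real (nat \<lfloor>y\<rfloor>)" "real (nat \<lfloor>y\<rfloor>) + 1 \<le> real (4 ^ (k + 1))"
    by linarith+
  moreover have "real (nat \<lfloor>y\<rfloor>) = \<lfloor>y\<rfloor>" using assms by simp
  ultimately have "real (4 ^ k) \<le> y" "y < real (4 ^ (k + 1))" by linarith+
  then show thesis using that[of k] by simp
qed

locale regular_bernstein = bernstein_representation +
  fixes \<beta> :: real
  assumes regular: "regularly_varying_at_zero \<beta> \<psi>" and beta: "0 < \<beta>" "\<beta> < 1"
begin

lemma psi_not_linear: "\<exists>x\<ge>0. \<psi> x \<noteq> x"
proof (rule ccontr)
  assume "\<not> ?thesis"
  then have id: "\<And>x. x \<ge> 0 \<Longrightarrow> \<psi> x = x" by auto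
  have "((\<lambda>x. \<psi> (4 * x) / \<psi> x) \<longlongrightarrow> 4) (at_right 0)"
    by (rule Lim_transform_eventually[OF tendsto_const])
      (auto simp: eventually_at_right_field id intro!: exI[of _ 1])
  with regularly_varying_ratio[OF regular, of 4] have "4 powr \<beta> = (4 powr 1 :: real)"
    by (auto dest: tendsto_unique[rotated])
  with powr_less_mono[of \<beta> 1 "4::real"] beta show False by simp
qed

lemma psi_scaling_lower:
  assumes "K > 0"
  obtains c \<gamma> where "c > 0" "\<gamma> > 0" "\<And>s m. s > 0 \<Longrightarrow> m \<ge> 1 \<Longrightarrow> m * s \<le> K \<Longrightarrow> c * m powr \<gamma> * \<psi> s \<le> \<psi> (m * s)"
proof -
  define \<gamma> where "\<gamma> = \<beta> / 2"
  define q :: real where "q = 4 powr \<gamma>"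
  have g: "\<gamma> > 0" and q: "q > 1" using beta by (auto simp: \<gamma>_def q_def)
  have "q < 4 powr \<beta>" unfolding q_def \<gamma>_def using beta by (intro powr_less_mono) auto
  with regularly_varying_ratio[OF regular, of 4]
  have "\<forall>\<^sub>F x in at_right 0. q < \<psi> (4 * x) / \<psi> x" by (intro order_tendstoD) auto
  then obtain s0 where s0: "s0 > 0" "\<And>x. 0 < x \<Longrightarrow> x < s0 \<Longrightarrow> q < \<psi> (4 * x) / \<psi> x"
    by (auto simp: eventually_at_right_field)
  have step: "q * \<psi> x \<le> \<psi> (4 * x)" if "0 < x" "x < s0" for x
    using s0(2)[OF that] psi_pos[OF that(1)] by (simp add: field_simps)
  have iter: "q ^ k * \<psi> s \<le> \<psi> (4 ^ k * s)" if "s > 0" "4 ^ k * s < s0" for k s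
    using that(2)
  proof (induction k)
    case (Suc k)
    have "4 ^ k * s \<le> 4 ^ Suc k * s" using that by (intro mult_right_mono) auto
    with Suc have less: "4 ^ k * s < s0" by linarith
    have "q ^ Suc k * \<psi> s \<le> q * \<psi> (4 ^ k * s)"
      using Suc.IH[OF less] q by (simp add: mult.assoc)
    also have "\<dots> \<le> \<psi> (4 * (4 ^ k * s))" using less that by (intro step) auto
    finally show ?case by (simp add: mult.assoc)
  qed simp
  define M where "M = max 1 (2 * K / s0)"
  have M: "M \<ge> 1" "2 * K / s0 \<le> M" by (auto simp: M_def)
  show thesis
  proof
    show "(1 / (4 * M)) powr \<gamma> > 0" using M by simp
    show "\<gamma> > 0" by (rule g)
    fix s m :: real
    assume s: "s > 0" and m: "m \<ge> 1" and ms: "m * s \<le> K"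
    have *: "(1 / (4 * M)) powr \<gamma> * m powr \<gamma> = (m / M / 4) powr \<gamma>"
      using M m by (simp add: powr_mult[symmetric] field_simps)
    show "(1 / (4 * M)) powr \<gamma> * m powr \<gamma> * \<psi> s \<le> \<psi> (m * s)"
    proof (cases "m / M \<ge> 1")
      case True
      then obtain k where k: "4 ^ k \<le> m / M" "m / M < 4 ^ (k + 1)"
        by (rule ex_power_4)
      have "(m / M) * s \<le> K / M" using ms M by (simp add: field_simps)
      also have "\<dots> < s0" using M s0 assms by (simp add: field_simps)
      finally have mMs: "(m / M) * s < s0" .
      have ks: "4 ^ k * s \<le> (m / M) * s" using k s by (intro mult_right_mono) auto
      have "(m / M / 4) powr \<gamma> \<le> (4 ^ k) powr \<gamma>"
        using k M m g by (intro powr_mono2) auto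
      also have "\<dots> = q ^ k"
        by (simp add: q_def powr_power powr_powr mult.commute flip: powr_realpow)
      finally have "(m / M / 4) powr \<gamma> * \<psi> s \<le> q ^ k * \<psi> s"
        using psi_nonneg[of s] s by (intro mult_right_mono) auto
      also have "\<dots> \<le> \<psi> (4 ^ k * s)" using s ks mMs by (intro iter) auto
      also have "\<dots> \<le> \<psi> (m * s)"
      proof (rule psi_mono)
        have "m / M * s \<le> m * s" using M m s by (intro mult_right_mono) (auto simp: field_simps)
        with ks show "4 ^ k * s \<le> m * s" by simp
      qed (use s in auto)
      finally show ?thesis unfolding * .
    next
      case False
      then have "(m / M / 4) powr \<gamma> \<le> 1 powr \<gamma>" using M m g by (intro powr_mono2) auto
      then have "(m / M / 4) powr \<gamma> * \<psi> s \<le> 1 * \<psi> s"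
        using psi_nonneg[of s] s by (intro mult_right_mono) auto
      also have "\<dots> \<le> \<psi> (m * s)" using s m by (auto intro!: psi_mono)
      finally show ?thesis unfolding * .
    qed
  qed
qed

lemma psi_ratio_tendsto:
  assumes r: "filterlim r (at_right 0) F" and l: "(l \<longlongrightarrow> L) F" and L: "L > 0"
  shows "((\<lambda>k. \<psi> (l k * r k) / \<psi> (r k)) \<longlongrightarrow> L powr \<beta>) F"
proof -
  have ev: "\<forall>\<^sub>F k in F. r k > 0" 
    using r by (simp add: filterlim_at) (auto elim: eventually_mono)
  have evl: "\<forall>\<^sub>F k in F. l k > 0" using l L by (rule order_tendstoD)
  have lim: "((\<lambda>k. \<psi> (L * r k) / \<psi> (r k)) \<longlongrightarrow> L powr \<beta>) F"
    using filterlim_compose[OF regularly_varying_ratio[OF regular L] r] .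
  have bnd: "\<psi> (y * x) \<le> max 1 y * \<psi> x" if "x > 0" "y > 0" for x y
  proof (cases "y \<ge> 1")
    case True then show ?thesis using psi_mult_le[of y x] that by (simp add: max_def)
  next
    case False then show ?thesis using psi_mono[of "y * x" x] that by (simp add: max_def mult_left_le_one_le)
  qed
  show ?thesis
  proof (rule tendsto_sandwich)
    show "\<forall>\<^sub>F k in F. (\<psi> (L * r k) / \<psi> (r k)) / max 1 (L / l k) \<le> \<psi> (l k * r k) / \<psi> (r k)"
      using ev evl
    proof eventually_elim
      case (elim k)
      then have "\<psi> (L * r k) / max 1 (L / l k) \<le> \<psi> (l k * r k)"
        using bnd[of "l k * r k" "L / l k"] L by (simp add: field_simps)
      then have "\<psi> (L * r k) / max 1 (L / l k) / \<psi> (r k) \<le> \<psi> (l k * r k) / \<psi> (r k)"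
        using elim psi_pos[of "r k"] by (intro divide_right_mono) auto
      then show ?case by (simp add: divide_divide_eq_left mult.commute)
    qed
    show "\<forall>\<^sub>F k in F. \<psi> (l k * r k) / \<psi> (r k) \<le> max 1 (l k / L) * (\<psi> (L * r k) / \<psi> (r k))"
      using ev evl
    proof eventually_elim
      case (elim k)
      then show ?case using bnd[of "L * r k" "l k / L"] L psi_pos[of "r k"]
        by (simp add: divide_right_mono)
    qed
    have "((\<lambda>k. max 1 (l k / L)) \<longlongrightarrow> max 1 (L / L)) F"
      using l L by (intro tendsto_intros) auto
    from tendsto_mult[OF this lim] show "((\<lambda>k. max 1 (l k / L) * (\<psi> (L * r k) / \<psi> (r k))) \<longlongrightarrow> L powr \<beta>) F"
      using L by simp
    have "((\<lambda>k. max 1 (L / l k)) \<longlongrightarrow> max 1 (L / L)) F"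
      using l L by (intro tendsto_intros) auto
    from tendsto_divide[OF lim this] show "((\<lambda>k. (\<psi> (L * r k) / \<psi> (r k)) / max 1 (L / l k)) \<longlongrightarrow> L powr \<beta>) F"
      using L by simp
  qed
qed

end

section \<open>The characteristic function of the walk\<close>

lemma cos_expansion_bound: "\<bar>1 - cos x - x\<^sup>2 / 2\<bar> \<le> x ^ 4 / 24" for x :: real
proof -
  obtain t where t: "cos x = (\<Sum>m<4. cos_coeff m * x ^ m) + cos (t + 1 / 2 * real 4 * pi) / fact 4 * x ^ 4"
    using Maclaurin_cos_expansion[of x 4] by blast
  have "(\<Sum>m<4. cos_coeff m * x ^ m) = 1 - x\<^sup>2 / 2"
  proof -
    have "{..<4} = {0, 1, 2, 3::nat}" by auto
    then show ?thesis by (simp add: cos_coeff_def fact_numeral)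
  qed
  then have "1 - cos x - x\<^sup>2 / 2 = - (cos (t + 1 / 2 * real 4 * pi) / fact 4 * x ^ 4)"
    using t by simp
  then have "\<bar>1 - cos x - x\<^sup>2 / 2\<bar> = \<bar>cos (t + 1 / 2 * real 4 * pi)\<bar> * (x ^ 4 / 24)"
    by (simp add: abs_mult fact_numeral)
  also have "\<dots> \<le> 1 * (x ^ 4 / 24)" by (intro mult_right_mono) auto
  finally show ?thesis by simp
qed

lemma one_minus_cos_ge:
  fixes x :: real
  assumes "\<bar>x\<bar> \<le> 1"
  shows "x\<^sup>2 / 4 \<le> 1 - cos x"
proof -
  have "x ^ 4 = x\<^sup>2 * x\<^sup>2" by (simp add: power2_eq_square power4_eq_xxxx)
  also have "\<dots> \<le> 1 * x\<^sup>2" using assms by (intro mult_right_mono) (auto simp: abs_square_le_1)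
  finally show ?thesis using cos_expansion_bound[of x] unfolding abs_le_iff by linarith
qed

lemma sin_expansion_bound: "\<bar>sin x - x\<bar> \<le> \<bar>x\<bar> ^ 3" for x :: real
proof -
  have "\<bar>sin x - x\<bar> \<le> inverse (fact 3) * \<bar>x\<bar> ^ 3"
    using Maclaurin_sin_bound[of x 3] by (simp add: numeral_eq_Suc sin_coeff_def)
  also have "\<dots> \<le> 1 * \<bar>x\<bar> ^ 3" by (intro mult_right_mono) (auto simp: fact_numeral)
  finally show ?thesis by simp
qed

lemma real_vec_axis_inner: "real_vec (axis i 1) \<bullet> \<theta> = \<theta> $ i"
proof -
  have "real_vec (axis i 1) = axis i 1" by (simp add: real_vec_def vec_eq_iff axis_def)
  then show ?thesis by (simp add: inner_axis')
qed

lemma Re_char_fun: "Re (char_fun p \<theta>) = (\<Sum>v\<in>set_pmf p. pmf p v * cos (real_vec v \<bullet> \<theta>))"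
  by (simp add: char_fun_def)

lemma Im_char_fun: "Im (char_fun p \<theta>) = (\<Sum>v\<in>set_pmf p. pmf p v * sin (real_vec v \<bullet> \<theta>))"
  by (simp add: char_fun_def)

locale lattice_walk =
  fixes p :: "(int ^ 'd) pmf"
  assumes walk: "walk_class p"
begin

lemma finite_support: "finite (set_pmf p)"
  using walk by (simp add: walk_class_def)

lemma support_induct:
  assumes "P 0" and "\<And>s v. P s \<Longrightarrow> v \<in> set_pmf p \<Longrightarrow> P (s + v)"
  shows "P x"
proof -
  obtain k where k: "pmf (conv_power p k) x > 0" using walk by (auto simp: walk_class_def)
  have "s \<in> set_pmf (conv_power p k) \<Longrightarrow> P s" for s
    by (induction k arbitrary: s) (use assms in auto)
  then show ?thesis using k by (auto simp: set_pmf_iff)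
qed

definition quad :: "real ^ 'd \<Rightarrow> real" where
  "quad \<theta> = (\<Sum>v\<in>set_pmf p. pmf p v * (real_vec v \<bullet> \<theta>)\<^sup>2)"

lemma quad_scaleR: "quad (t *\<^sub>R \<theta>) = t\<^sup>2 * quad \<theta>"
  unfolding quad_def sum_distrib_left
  by (rule sum.cong) (auto simp: power_mult_distrib)

lemma quad_pos:
  assumes "\<theta> \<noteq> 0"
  shows "quad \<theta> > 0"
proof (rule ccontr)
  assume "\<not> quad \<theta> > 0"
  moreover have nn: "\<And>v. v \<in> set_pmf p \<Longrightarrow> 0 \<le> pmf p v * (real_vec v \<bullet> \<theta>)\<^sup>2" by simp
  ultimately have "quad \<theta> = 0" unfolding quad_def by (meson not_less order_antisym sum_nonneg)
  then have v0: "real_vec v \<bullet> \<theta> = 0" if "v \<in> set_pmf p" for v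
    using that finite_support unfolding quad_def
    by (subst (asm) sum_nonneg_eq_0_iff) (auto simp: set_pmf_iff)
  have "real_vec x \<bullet> \<theta> = 0" for x
    by (rule support_induct[of "\<lambda>x. real_vec x \<bullet> \<theta> = 0"])
      (auto simp: v0 real_vec_zero real_vec_add inner_add_left)
  from this[of "axis i 1" for i] have "\<theta> = 0" by (simp add: real_vec_axis_inner vec_eq_iff)
  with assms show False ..
qed

lemma quad_ge:
  obtains c where "c > 0" "\<And>\<theta>. c * (norm \<theta>)\<^sup>2 \<le> quad \<theta>"
proof -
  have "compact (sphere (0::real^'d) 1)" by simp
  moreover have "sphere (0::real^'d) 1 \<noteq> {}" by simp
  moreover have "continuous_on (sphere 0 1) quad"
    unfolding quad_def by (intro continuous_intros)
  ultimately have "\<exists>e\<in>sphere 0 1. \<forall>y\<in>sphere 0 1. quad e \<le> quad y"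
    by (rule continuous_attains_inf)
  then obtain e where e: "e \<in> sphere 0 1" "\<And>y. y \<in> sphere 0 1 \<Longrightarrow> quad e \<le> quad y"
    by auto
  show thesis
  proof
    show "quad e > 0" using e by (intro quad_pos) auto
    fix \<theta>
    show "quad e * (norm \<theta>)\<^sup>2 \<le> quad \<theta>"
    proof (cases "\<theta> = 0")
      case False
      have "quad \<theta> = quad (norm \<theta> *\<^sub>R (\<theta> /\<^sub>R norm \<theta>))" using False by simp
      also have "\<dots> = (norm \<theta>)\<^sup>2 * quad (\<theta> /\<^sub>R norm \<theta>)"
        by (rule quad_scaleR)
      also have "\<dots> \<ge> (norm \<theta>)\<^sup>2 * quad e"
        using False by (intro mult_left_mono e) auto
      finally show ?thesis by (simp add: mult.commute)
    qed (simp add: quad_def)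
  qed
qed

lemma support_bounded:
  obtains B where "B > 0" "\<And>v \<theta>. v \<in> set_pmf p \<Longrightarrow> \<bar>real_vec v \<bullet> \<theta>\<bar> \<le> B * norm \<theta>"
proof -
  define B where "B = 1 + (\<Sum>v\<in>set_pmf p. norm (real_vec v))"
  show thesis
  proof
    show "B > 0" unfolding B_def by (simp add: add_pos_nonneg sum_nonneg)
    fix v \<theta> assume "v \<in> set_pmf p"
    then have "norm (real_vec v) \<le> B"
      unfolding B_def using finite_support by (intro order_trans[OF member_le_sum[of v "set_pmf p" "\<lambda>v. norm (real_vec v)"]]) auto
    then show "\<bar>real_vec v \<bullet> \<theta>\<bar> \<le> B * norm \<theta>"
      using Cauchy_Schwarz_ineq2[of "real_vec v" \<theta>] by (meson mult_right_mono norm_ge_zero order_trans)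
  qed
qed

lemma sum_pmf_support: "(\<Sum>v\<in>set_pmf p. pmf p v) = 1"
  using finite_support by (simp add: sum_pmf_eq_1)

lemma one_minus_Re_char_fun: "1 - Re (char_fun p \<theta>) = (\<Sum>v\<in>set_pmf p. pmf p v * (1 - cos (real_vec v \<bullet> \<theta>)))"
  by (simp add: Re_char_fun right_diff_distrib sum_subtractf sum_pmf_support)

lemma one_minus_Re_char_fun_nonneg: "0 \<le> 1 - Re (char_fun p \<theta>)"
  unfolding one_minus_Re_char_fun by (intro sum_nonneg) simp

lemma one_minus_Re_char_fun_ge_near_0:
  obtains c \<delta> where "c > 0" "\<delta> > 0" "\<And>\<theta>. norm \<theta> \<le> \<delta> \<Longrightarrow> c * (norm \<theta>)\<^sup>2 \<le> 1 - Re (char_fun p \<theta>)"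
proof -
  obtain B where B: "B > 0" "\<And>v \<theta>. v \<in> set_pmf p \<Longrightarrow> \<bar>real_vec v \<bullet> \<theta>\<bar> \<le> B * norm \<theta>"
    by (rule support_bounded) blast
  obtain c where c: "c > 0" "\<And>\<theta>. c * (norm \<theta>)\<^sup>2 \<le> quad \<theta>" by (rule quad_ge) blast
  show thesis
  proof
    show "c / 4 > 0" "1 / B > 0" using B c by auto
    fix \<theta> :: "real^'d" assume "norm \<theta> \<le> 1 / B"
    then have "B * norm \<theta> \<le> 1" using B by (simp add: field_simps)
    then have le1: "\<bar>real_vec v \<bullet> \<theta>\<bar> \<le> 1" if "v \<in> set_pmf p" for v
      using B(2)[OF that, of \<theta>] by linarith
    have "c / 4 * (norm \<theta>)\<^sup>2 \<le> quad \<theta> / 4" using c(2)[of \<theta>] by simp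
    also have "\<dots> = (\<Sum>v\<in>set_pmf p. pmf p v * ((real_vec v \<bullet> \<theta>)\<^sup>2 / 4))"
      by (simp add: quad_def sum_divide_distrib)
    also have "\<dots> \<le> 1 - Re (char_fun p \<theta>)"
      unfolding one_minus_Re_char_fun
      by (intro sum_mono mult_left_mono one_minus_cos_ge le1) auto
    finally show "c / 4 * (norm \<theta>)\<^sup>2 \<le> 1 - Re (char_fun p \<theta>)" .
  qed
qed

text \<open>The walk may be periodic, so \<open>|\<phi>|\<close> can be 1 away from the origin; this is why the bounds on the
  whole cube are stated for \<open>1 - Re \<phi>\<close>.\<close>

lemma one_minus_Re_char_fun_pos:
  assumes "\<theta> \<in> torus_cube" "\<theta> \<noteq> 0"
  shows "0 < 1 - Re (char_fun p \<theta>)"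
proof (rule ccontr)
  assume "\<not> ?thesis"
  then have "1 - Re (char_fun p \<theta>) = 0" using one_minus_Re_char_fun_nonneg[of \<theta>] by linarith
  then have "cos (real_vec v \<bullet> \<theta>) = 1" if "v \<in> set_pmf p" for v
    using that finite_support unfolding one_minus_Re_char_fun
    by (subst (asm) sum_nonneg_eq_0_iff) (auto simp: set_pmf_iff)
  then have v1: "cis (real_vec v \<bullet> \<theta>) = 1" if "v \<in> set_pmf p" for v
    using that by (simp add: complex_eq_iff cos_one_sin_zero)
  have "cis (real_vec x \<bullet> \<theta>) = 1" for x
    by (rule support_induct[of "\<lambda>x. cis (real_vec x \<bullet> \<theta>) = 1"])
      (auto simp: v1 real_vec_zero real_vec_add inner_add_left cis_mult[symmetric])
  then have c1: "cos (\<theta> $ i) = 1" for i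
    by (metis real_vec_axis_inner cis.sel(1) one_complex.sel(1))
  have "\<theta> $ i = 0" for i
  proof -
    obtain m :: int where m: "\<theta> $ i = m * 2 * pi" using c1[of i] unfolding cos_one_2pi_int by auto
    have "\<bar>\<theta> $ i\<bar> \<le> pi" using assms by (simp add: mem_torus_cube)
    then have "\<bar>real_of_int m\<bar> * 2 \<le> 1" unfolding m by (simp add: abs_mult)
    then have "m = 0" by linarith
    then show ?thesis using m by simp
  qed
  then show False using assms by (simp add: vec_eq_iff)
qed

lemma torus_cube_bounded:
  obtains K where "K > 0" "\<And>\<theta>. \<theta> \<in> (torus_cube :: (real^'d) set) \<Longrightarrow> norm \<theta> \<le> K"
  using bounded_cbox[of "\<chi> i. - pi" "\<chi> i::'d. pi"] unfolding bounded_pos torus_cube_def by auto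

lemma one_minus_Re_char_fun_ge:
  obtains c where "c > 0" "\<And>\<theta>. \<theta> \<in> torus_cube \<Longrightarrow> c * (norm \<theta>)\<^sup>2 \<le> 1 - Re (char_fun p \<theta>)"
proof -
  obtain c \<delta> where c: "c > 0" "\<delta> > 0" "\<And>\<theta>. norm \<theta> \<le> \<delta> \<Longrightarrow> c * (norm \<theta>)\<^sup>2 \<le> 1 - Re (char_fun p \<theta>)"
    by (rule one_minus_Re_char_fun_ge_near_0) blast
  obtain K where K: "K > 0" "\<And>\<theta>. \<theta> \<in> (torus_cube :: (real^'d) set) \<Longrightarrow> norm \<theta> \<le> K"
    by (rule torus_cube_bounded) blast
  let ?S = "torus_cube - ball (0::real^'d) \<delta>"
  show thesis
  proof (cases "?S = {}")
    case True
    then have "norm \<theta> \<le> \<delta>" if "\<theta> \<in> (torus_cube :: (real^'d) set)" for \<theta> using that by (auto simp: dist_norm)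
    then show thesis using c that by blast
  next
    case False
    have "compact ?S" unfolding torus_cube_def by (intro compact_diff) auto
    moreover have "continuous_on ?S (\<lambda>\<theta>. 1 - Re (char_fun p \<theta>))"
      unfolding Re_char_fun by (intro continuous_intros)
    ultimately have "\<exists>e\<in>?S. \<forall>y\<in>?S. 1 - Re (char_fun p e) \<le> 1 - Re (char_fun p y)"
      by (intro continuous_attains_inf False)
    then obtain e where e: "e \<in> ?S" "\<And>y. y \<in> ?S \<Longrightarrow> 1 - Re (char_fun p e) \<le> 1 - Re (char_fun p y)"
      by auto
    define m where "m = 1 - Re (char_fun p e)"
    have m: "m > 0" unfolding m_def using e(1) c(2) by (intro one_minus_Re_char_fun_pos) auto
    show thesis
    proof
      show "min c (m / K\<^sup>2) > 0" using c m K by simp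
      fix \<theta> :: "real^'d" assume \<theta>: "\<theta> \<in> torus_cube"
      show "min c (m / K\<^sup>2) * (norm \<theta>)\<^sup>2 \<le> 1 - Re (char_fun p \<theta>)"
      proof (cases "norm \<theta> \<le> \<delta>")
        case True
        have "min c (m / K\<^sup>2) * (norm \<theta>)\<^sup>2 \<le> c * (norm \<theta>)\<^sup>2" by (intro mult_right_mono) auto
        with c(3)[OF True] show ?thesis by linarith
      next
        case False
        then have "m \<le> 1 - Re (char_fun p \<theta>)" unfolding m_def using \<theta> by (intro e) auto
        moreover have "min c (m / K\<^sup>2) * (norm \<theta>)\<^sup>2 \<le> (m / K\<^sup>2) * K\<^sup>2"
          using K m \<theta> by (intro mult_mono power_mono) auto
        ultimately show ?thesis using K by simp
      qed
    qed
  qed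
qed

lemma Im_char_fun_bound:
  obtains C where "C > 0" "\<And>\<theta>. \<bar>Im (char_fun p \<theta>)\<bar> \<le> C * norm \<theta> ^ 3"
proof -
  obtain B where B: "B > 0" "\<And>v \<theta>. v \<in> set_pmf p \<Longrightarrow> \<bar>real_vec v \<bullet> \<theta>\<bar> \<le> B * norm \<theta>"
    by (rule support_bounded) blast
  show thesis
  proof
    show "B ^ 3 > 0" using B by simp
    fix \<theta>
    have "(\<Sum>v\<in>set_pmf p. pmf p v * (real_vec v \<bullet> \<theta>)) = (\<Sum>v\<in>set_pmf p. pmf p v *\<^sub>R real_vec v) \<bullet> \<theta>"
      by (simp add: inner_sum_left)
    also have "\<dots> = 0" using walk by (simp add: walk_class_def)
    finally have "Im (char_fun p \<theta>) = (\<Sum>v\<in>set_pmf p. pmf p v * (sin (real_vec v \<bullet> \<theta>) - real_vec v \<bullet> \<theta>))"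
      by (simp add: Im_char_fun right_diff_distrib sum_subtractf)
    also have "\<bar>\<dots>\<bar> \<le> (\<Sum>v\<in>set_pmf p. pmf p v * (B ^ 3 * norm \<theta> ^ 3))"
    proof (rule order_trans[OF sum_abs], rule sum_mono)
      fix v assume v: "v \<in> set_pmf p"
      have "\<bar>sin (real_vec v \<bullet> \<theta>) - real_vec v \<bullet> \<theta>\<bar> \<le> \<bar>real_vec v \<bullet> \<theta>\<bar> ^ 3" by (rule sin_expansion_bound)
      also have "\<dots> \<le> (B * norm \<theta>) ^ 3" using B(2)[OF v] by (intro power_mono) auto
      finally show "\<bar>pmf p v * (sin (real_vec v \<bullet> \<theta>) - real_vec v \<bullet> \<theta>)\<bar> \<le> pmf p v * (B ^ 3 * norm \<theta> ^ 3)"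
        by (simp add: abs_mult mult_left_mono power_mult_distrib)
    qed
    also have "\<dots> = B ^ 3 * norm \<theta> ^ 3" by (simp add: sum_distrib_right[symmetric] sum_pmf_support)
    finally show "\<bar>Im (char_fun p \<theta>)\<bar> \<le> B ^ 3 * norm \<theta> ^ 3" .
  qed
qed

lemma continuous_on_char_fun: "continuous_on A (char_fun p)"
  unfolding char_fun_def by (intro continuous_intros)

lemma char_fun_0: "char_fun p 0 = 1"
proof -
  have "char_fun p 0 = of_real (\<Sum>v\<in>set_pmf p. pmf p v)" by (simp add: char_fun_def scaleR_conv_of_real)
  then show ?thesis by (simp add: sum_pmf_support)
qed

lemma norm_char_fun_near_0:
  obtains c \<delta> where "c > 0" "\<delta> > 0" "\<And>\<theta>. norm \<theta> \<le> \<delta> \<Longrightarrow> norm (char_fun p \<theta>) \<le> 1 - c * (norm \<theta>)\<^sup>2"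
    "\<And>\<theta>. norm \<theta> \<le> \<delta> \<Longrightarrow> 0 \<le> Re (char_fun p \<theta>)"
proof -
  obtain c \<delta> where c: "c > 0" "\<delta> > 0" "\<And>\<theta>. norm \<theta> \<le> \<delta> \<Longrightarrow> c * (norm \<theta>)\<^sup>2 \<le> 1 - Re (char_fun p \<theta>)"
    by (rule one_minus_Re_char_fun_ge_near_0) blast
  obtain C where C: "C > 0" "\<And>\<theta>. \<bar>Im (char_fun p \<theta>)\<bar> \<le> C * norm \<theta> ^ 3" by (rule Im_char_fun_bound) blast
  have "isCont (char_fun p) 0" using continuous_on_char_fun[of UNIV] by (simp add: continuous_on_eq_continuous_at)
  then have "\<forall>\<^sub>F \<theta> in nhds 0. dist (char_fun p \<theta>) 1 < 1"
    by (intro tendstoD) (auto simp: isCont_def tendsto_nhds_iff char_fun_0)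
  then obtain d where d: "d > 0" "\<And>\<theta>. norm \<theta> < d \<Longrightarrow> norm (char_fun p \<theta> - 1) < 1"
    by (auto simp: eventually_nhds_metric dist_norm)
  have Re0: "0 \<le> Re (char_fun p \<theta>)" if "norm \<theta> < d" for \<theta>
    using d(2)[OF that] abs_Re_le_cmod[of "char_fun p \<theta> - 1"] by simp
  show thesis
  proof
    let ?d = "min (d / 2) (min \<delta> (c / (2 * C)))"
    show "c / 2 > 0" "?d > 0" using c C d by auto
    fix \<theta> :: "real^'d" assume t: "norm \<theta> \<le> ?d"
    then have "norm \<theta> < d" using d by simp
    then show R0: "0 \<le> Re (char_fun p \<theta>)" by (rule Re0)
    have "norm (char_fun p \<theta>) \<le> \<bar>Re (char_fun p \<theta>)\<bar> + \<bar>Im (char_fun p \<theta>)\<bar>" by (rule cmod_le)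
    also have "\<dots> \<le> 1 - c * (norm \<theta>)\<^sup>2 + (C * norm \<theta>) * (norm \<theta>)\<^sup>2"
      using R0 c(3)[of \<theta>] C(2)[of \<theta>] t by (simp add: power3_eq_cube power2_eq_square mult.assoc)
    also have "(C * norm \<theta>) * (norm \<theta>)\<^sup>2 \<le> (c / 2) * (norm \<theta>)\<^sup>2"
      using t C by (intro mult_right_mono) (auto simp: field_simps)
    finally show "norm (char_fun p \<theta>) \<le> 1 - c / 2 * (norm \<theta>)\<^sup>2" by simp
  qed
qed

lemma one_minus_Re_char_fun_tendsto:
  assumes r: "filterlim r (at_right 0) F"
  shows "((\<lambda>k. (1 - Re (char_fun p (r k *\<^sub>R u))) / (r k)\<^sup>2) \<longlongrightarrow> quad u / 2) F"
proof -
  have ev: "\<forall>\<^sub>F k in F. r k > 0" 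
    using r by (simp add: filterlim_at) (auto elim: eventually_mono)
  have r0: "(r \<longlongrightarrow> 0) F" using r by (simp add: filterlim_at)
  have "((\<lambda>k. (1 - cos (r k * y)) / (r k)\<^sup>2) \<longlongrightarrow> y\<^sup>2 / 2) F" for y
  proof (rule Lim_transform2)
    show "((\<lambda>k. y\<^sup>2 / 2) \<longlongrightarrow> y\<^sup>2 / 2) F" by simp
    show "((\<lambda>k. y\<^sup>2 / 2 - (1 - cos (r k * y)) / (r k)\<^sup>2) \<longlongrightarrow> 0) F"
    proof (rule Lim_null_comparison)
      show "((\<lambda>k. (r k)\<^sup>2 * y ^ 4 / 24) \<longlongrightarrow> 0) F"
        using r0 by (auto intro!: tendsto_eq_intros)
      show "\<forall>\<^sub>F k in F. norm (y\<^sup>2 / 2 - (1 - cos (r k * y)) / (r k)\<^sup>2) \<le> (r k)\<^sup>2 * y ^ 4 / 24"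
        using ev
      proof eventually_elim
        case (elim k)
        have "y\<^sup>2 / 2 - (1 - cos (r k * y)) / (r k)\<^sup>2 = - (1 - cos (r k * y) - (r k * y)\<^sup>2 / 2) / (r k)\<^sup>2"
          using elim by (simp add: field_simps power_mult_distrib)
        also have "norm \<dots> = \<bar>1 - cos (r k * y) - (r k * y)\<^sup>2 / 2\<bar> / (r k)\<^sup>2"
          by (simp only: real_norm_def abs_divide abs_minus_cancel abs_power2)
        also have "\<dots> \<le> ((r k * y) ^ 4 / 24) / (r k)\<^sup>2"
          by (intro divide_right_mono cos_expansion_bound) simp
        also have "\<dots> = (r k)\<^sup>2 * y ^ 4 / 24"
          using elim by (simp add: field_simps power_mult_distrib power4_eq_xxxx power2_eq_square)
        finally show ?case .
      qed
    qed
  qed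
  then have "((\<lambda>k. \<Sum>v\<in>set_pmf p. pmf p v * ((1 - cos (r k * (real_vec v \<bullet> u))) / (r k)\<^sup>2)) \<longlongrightarrow> (\<Sum>v\<in>set_pmf p. pmf p v * ((real_vec v \<bullet> u)\<^sup>2 / 2))) F"
    by (intro tendsto_sum tendsto_mult tendsto_const)
  then show ?thesis
    by (simp add: one_minus_Re_char_fun quad_def sum_divide_distrib)
qed

lemma norm_le_walk_norm:
  obtains C where "C > 0" "\<And>x. norm (real_vec x) \<le> C * walk_norm p x"
proof -
  let ?Q = "cov_matrix p"
  obtain c where c: "c > 0" "\<And>\<theta>. c * (norm \<theta>)\<^sup>2 \<le> quad \<theta>" by (rule quad_ge) blast
  have Qq: "(?Q *v u) \<bullet> u = quad u" for u unfolding inner_cov_matrix quad_def ..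
  have "inj ((*v) ?Q)"
  proof (subst linear_injective_0)
    show "\<forall>u. ?Q *v u = 0 \<longrightarrow> u = 0"
    proof (intro allI impI)
      fix u assume "?Q *v u = 0"
      then show "u = 0" using Qq[of u] quad_pos[of u] by fastforce
    qed
  qed simp
  then have "invertible ?Q"
    using matrix_left_invertible_injective[of ?Q] invertible_left_inverse[of ?Q] by (auto simp: inj_def)
  then have "?Q ** matrix_inv ?Q = mat 1"
    unfolding invertible_def matrix_inv_def by (rule someI2_ex) simp
  then have inv: "?Q *v (matrix_inv ?Q *v x) = x" for x
    by (simp add: matrix_vector_mul_assoc)
  obtain D where D: "D > 0" "\<And>y. norm (?Q *v y) \<le> norm y * D"
    using bounded_linear.pos_bounded[OF matrix_vector_mul_bounded_linear[of ?Q]] by blast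
  show thesis
  proof
    show "D / sqrt c > 0" using D c by simp
    fix x
    define y where "y = matrix_inv ?Q *v real_vec x"
    have "walk_norm p x = sqrt (quad y)"
      unfolding walk_norm_def y_def[symmetric] Qq[symmetric] using inv[of "real_vec x"] by (simp add: y_def inner_commute)
    moreover have "sqrt c * norm y \<le> sqrt (quad y)"
      using real_sqrt_le_mono[OF c(2)[of y]] by (simp add: real_sqrt_mult)
    moreover have "norm (real_vec x) \<le> norm y * D"
      using D(2)[of y] inv[of "real_vec x"] by (simp add: y_def)
    moreover have "norm y * D = D / sqrt c * (sqrt c * norm y)" using c by simp
    ultimately show "norm (real_vec x) \<le> D / sqrt c * walk_norm p x"
      using D c mult_left_mono[of "sqrt c * norm y" "walk_norm p x" "D / sqrt c"] by simp
  qed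
qed

end

section \<open>The subordinate walk\<close>

lemma summable_stretched_exp:
  assumes "\<kappa> > 0" "\<delta> > 0"
  shows "summable (\<lambda>j. exp (- \<kappa> * real j powr \<delta>) * real (j + 1) ^ d)"
proof (rule summable_comparison_test_bigo)
  show "summable (\<lambda>j. norm (1 / real j ^ 2))"
    using inverse_power_summable[of 2, where 'a=real] by (simp add: field_simps)
  have "(\<lambda>j. exp (- \<kappa> * real j powr \<delta>) * (real j + 1) powr real d) \<in> O(\<lambda>j. 1 / real j ^ 2)"
    using assms by real_asymp
  moreover have "real (j + 1) ^ d = (real j + 1) powr real d" for j
    by (simp add: powr_realpow add.commute)
  ultimately show "(\<lambda>j. exp (- \<kappa> * real j powr \<delta>) * real (j + 1) ^ d) \<in> O(\<lambda>j. 1 / real j ^ 2)"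
    by simp
qed

lemma integrable_stretched_exp:
  assumes "\<kappa> > 0" "\<delta> > 0"
  shows "integrable lborel (\<lambda>u::'a::euclidean_space. exp (- \<kappa> * norm u powr \<delta>))"
proof (rule integrableI_bounded)
  let ?g = "\<lambda>j::nat. exp (- \<kappa> * real j powr \<delta>)"
  let ?V = "unit_ball_vol (real DIM('a))"
  show "(\<lambda>u::'a. exp (- \<kappa> * norm u powr \<delta>)) \<in> borel_measurable lborel" by measurable
  have le: "ennreal (norm (exp (- \<kappa> * norm u powr \<delta>))) \<le> (\<Sum>j. ennreal (?g j) * indicator (ball 0 (real j + 1)) u)" for u :: 'a
  proof -
    define j where "j = nat \<lfloor>norm u\<rfloor>"
    have j: "real j \<le> norm u" "norm u < real j + 1" unfolding j_def by (auto simp: of_nat_nat)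
    have "ennreal (norm (exp (- \<kappa> * norm u powr \<delta>))) \<le> ennreal (?g j)"
      using j assms by (auto intro!: ennreal_leI mult_left_mono powr_mono2)
    also have "\<dots> = (\<Sum>j\<in>{j}. ennreal (?g j) * indicator (ball 0 (real j + 1)) u)"
      using j by simp
    also have "\<dots> \<le> (\<Sum>j. ennreal (?g j) * indicator (ball 0 (real j + 1)) u)"
      by (intro sum_le_suminf) auto
    finally show ?thesis .
  qed
  have meas: "(\<lambda>u::'a. ennreal (?g j) * indicator (ball 0 (real j + 1)) u) \<in> borel_measurable lborel" for j
    by (intro borel_measurable_times_ennreal borel_measurable_const borel_measurable_indicator) simp
  have "(\<integral>\<^sup>+u. ennreal (norm (exp (- \<kappa> * norm (u::'a) powr \<delta>))) \<partial>lborel) \<le>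
     (\<integral>\<^sup>+u. (\<Sum>j. ennreal (?g j) * indicator (ball 0 (real j + 1)) (u::'a)) \<partial>lborel)"
    by (intro nn_integral_mono le)
  also have "\<dots> = (\<Sum>j. \<integral>\<^sup>+u. ennreal (?g j) * indicator (ball 0 (real j + 1)) (u::'a) \<partial>lborel)"
    by (rule nn_integral_suminf) (rule meas)
  also have "\<dots> = (\<Sum>j. ennreal (?V * (?g j * real (j + 1) ^ DIM('a))))"
  proof (rule suminf_cong)
    fix j
    have "(\<integral>\<^sup>+u. ennreal (?g j) * indicator (ball 0 (real j + 1)) (u::'a) \<partial>lborel) =
      ennreal (?g j) * ennreal (?V * (real j + 1) ^ DIM('a))"
      by (subst nn_integral_cmult_indicator) (auto simp: emeasure_ball)
    also have "\<dots> = ennreal (?V * (?g j * real (j + 1) ^ DIM('a)))"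
      by (subst ennreal_mult[symmetric]) (auto simp: mult_ac add_ac)
    finally show "(\<integral>\<^sup>+u. ennreal (?g j) * indicator (ball 0 (real j + 1)) (u::'a) \<partial>lborel) =
      ennreal (?V * (?g j * real (j + 1) ^ DIM('a)))" .
  qed
  also have "\<dots> < \<infinity>"
    using summable_mult[OF summable_stretched_exp[OF assms, of "DIM('a)"], of ?V]
    by (subst suminf_ennreal2) auto
  finally show "(\<integral>\<^sup>+u. ennreal (norm (exp (- \<kappa> * norm (u::'a) powr \<delta>))) \<partial>lborel) < \<infinity>" .
qed

lemma lborel_integral_scale:
  fixes f :: "'a::euclidean_space \<Rightarrow> complex"
  assumes f[measurable]: "f \<in> borel_measurable borel" and c: "c > 0"
  shows "(\<integral>x. f x \<partial>lborel) = c ^ DIM('a) *\<^sub>R (\<integral>x. f (c *\<^sub>R x) \<partial>lborel)"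
  using c by (subst lborel_affine[of c 0]) (simp_all add: integral_density integral_distr)

locale subordinated_walk = regular_bernstein \<psi> a b \<nu> \<beta> + lattice_walk p
  for \<psi> a b \<nu> \<beta> and p :: "(int ^ 'd) pmf"
begin

definition sub_char_fun :: "real ^ 'd \<Rightarrow> complex" where
  "sub_char_fun \<theta> = pgf (subordinator_step b \<nu>) (char_fun p \<theta>)"

lemma sub_char_fun_measurable [measurable]: "sub_char_fun \<in> borel_measurable borel"
  using borel_measurable_pgf_char_fun[of "subordinator_step b \<nu>" p]
  by (simp add: sub_char_fun_def[abs_def])

lemma pgf_subordinator_of_real:
  assumes "0 \<le> s" "s \<le> 1"
  shows "pgf (subordinator_step b \<nu>) (of_real s) = of_real (1 - \<psi> (1 - s))"
proof -
  have "(\<lambda>k. pmf (subordinator_step b \<nu>) k *\<^sub>R complex_of_real s ^ k) sums of_real (1 - \<psi> (1 - s))"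
    using sums_of_real[OF subordinator_step_sums[OF assms], where 'a=complex] by (simp add: scaleR_conv_of_real)
  then show ?thesis unfolding pgf_def by (rule sums_unique[symmetric])
qed

lemma sub_char_fun_0: "sub_char_fun 0 = 1"
  using pgf_subordinator_of_real[of 1] by (simp add: sub_char_fun_def char_fun_0 psi_0)

lemma psi_le_mult:
  assumes "c > 0" "x \<ge> 0"
  shows "min c 1 * \<psi> x \<le> \<psi> (c * x)"
proof (cases "c \<ge> 1")
  case True
  then show ?thesis using psi_mono[of x "c * x"] assms by (simp add: mult_le_cancel_right1)
next
  case False
  then show ?thesis using psi_mult_le[of "1 / c" "c * x"] assms by (simp add: field_simps min_def)
qed

lemma norm_sub_char_fun_le:
  obtains c where "c > 0" "\<And>\<theta>. \<theta> \<in> torus_cube \<Longrightarrow> norm (sub_char_fun \<theta>) \<le> exp (- c * \<psi> ((norm \<theta>)\<^sup>2))"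
proof -
  let ?R = "subordinator_step b \<nu>"
  obtain c \<delta> where c: "c > 0" "\<delta> > 0" "\<And>\<theta>. norm \<theta> \<le> \<delta> \<Longrightarrow> norm (char_fun p \<theta>) \<le> 1 - c * (norm \<theta>)\<^sup>2"
    by (rule norm_char_fun_near_0) blast
  obtain c2 where c2: "c2 > 0" "\<And>\<theta>. \<theta> \<in> torus_cube \<Longrightarrow> c2 * (norm \<theta>)\<^sup>2 \<le> 1 - Re (char_fun p \<theta>)"
    by (rule one_minus_Re_char_fun_ge) blast
  obtain x where "x \<ge> 0" "\<psi> x \<noteq> x" using psi_not_linear by auto
  then have "pmf ?R 1 > 0" "pmf ?R 2 > 0" by (auto intro: subordinator_step_pos)
  then obtain \<kappa> where \<kappa>: "\<kappa> > 0" "\<And>z. norm z \<le> 1 \<Longrightarrow> norm (pgf ?R z) \<le> 1 - \<kappa> * (1 - Re z)"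
    by (rule norm_pgf_le_Re) blast
  obtain K where K: "K > 0" "\<And>\<theta>. \<theta> \<in> (torus_cube :: (real^'d) set) \<Longrightarrow> norm \<theta> \<le> K"
    by (rule torus_cube_bounded) blast
  note n1 = norm_char_fun_le_1[OF finite_support]
  define e where "e = min (min c 1) (\<kappa> * c2 * \<delta>\<^sup>2 / \<psi> (K\<^sup>2))"
  have pK: "\<psi> (K\<^sup>2) > 0" using K by (intro psi_pos) simp
  show thesis
  proof
    show "e > 0" using c c2 \<kappa> pK by (simp add: e_def)
    fix \<theta> :: "real^'d" assume \<theta>: "\<theta> \<in> torus_cube"
    have "norm (sub_char_fun \<theta>) \<le> 1 - e * \<psi> ((norm \<theta>)\<^sup>2)"
    proof (cases "norm \<theta> \<le> \<delta>")
      case True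
      let ?m = "norm (char_fun p \<theta>)"
      have "norm (sub_char_fun \<theta>) \<le> 1 - \<psi> (1 - ?m)"
        unfolding sub_char_fun_def by (intro norm_pgf_le n1 subordinator_step_sums) simp
      moreover have "\<psi> (c * (norm \<theta>)\<^sup>2) \<le> \<psi> (1 - ?m)"
        using c(3)[OF True] c(1) by (intro psi_mono) auto
      moreover have "min c 1 * \<psi> ((norm \<theta>)\<^sup>2) \<le> \<psi> (c * (norm \<theta>)\<^sup>2)"
        using c(1) by (intro psi_le_mult) auto
      moreover have "e * \<psi> ((norm \<theta>)\<^sup>2) \<le> min c 1 * \<psi> ((norm \<theta>)\<^sup>2)"
        by (intro mult_right_mono psi_nonneg) (auto simp: e_def)
      ultimately show ?thesis by linarith
    next
      case False
      have "norm (sub_char_fun \<theta>) \<le> 1 - \<kappa> * (1 - Re (char_fun p \<theta>))"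
        unfolding sub_char_fun_def by (intro \<kappa> n1)
      moreover have "\<kappa> * (c2 * \<delta>\<^sup>2) \<le> \<kappa> * (1 - Re (char_fun p \<theta>))"
      proof (rule mult_left_mono)
        have "c2 * \<delta>\<^sup>2 \<le> c2 * (norm \<theta>)\<^sup>2"
          using c2(1) c(2) False by (intro mult_left_mono power_mono) auto
        with c2(2)[OF \<theta>] show "c2 * \<delta>\<^sup>2 \<le> 1 - Re (char_fun p \<theta>)" by linarith
      qed (use \<kappa> in auto)
      moreover have "e * \<psi> ((norm \<theta>)\<^sup>2) \<le> \<kappa> * c2 * \<delta>\<^sup>2 / \<psi> (K\<^sup>2) * \<psi> (K\<^sup>2)"
        using K(2)[OF \<theta>] \<kappa> c2 pK
        by (intro mult_mono psi_mono power_mono psi_nonneg) (auto simp: e_def)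
      ultimately show ?thesis using pK by simp
    qed
    also have "\<dots> \<le> exp (- e * \<psi> ((norm \<theta>)\<^sup>2))"
      using exp_ge_add_one_self[of "- e * \<psi> ((norm \<theta>)\<^sup>2)"] by simp
    finally show "norm (sub_char_fun \<theta>) \<le> exp (- e * \<psi> ((norm \<theta>)\<^sup>2))" .
  qed
qed

lemma scaled_power_bound:
  obtains \<kappa> \<delta> where "\<kappa> > 0" "\<delta> > 0"
    "\<And>n r u. r > 0 \<Longrightarrow> real n * \<psi> (r\<^sup>2) = 1 \<Longrightarrow>
      indicator torus_cube (r *\<^sub>R u) * norm (sub_char_fun (r *\<^sub>R u) ^ n) \<le> exp \<kappa> * exp (- \<kappa> * norm u powr \<delta>)"
proof -
  obtain c where c: "c > 0" "\<And>\<theta>. \<theta> \<in> torus_cube \<Longrightarrow> norm (sub_char_fun \<theta>) \<le> exp (- c * \<psi> ((norm \<theta>)\<^sup>2))"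
    by (rule norm_sub_char_fun_le) blast
  obtain K where K: "K > 0" "\<And>\<theta>. \<theta> \<in> (torus_cube :: (real^'d) set) \<Longrightarrow> norm \<theta> \<le> K"
    by (rule torus_cube_bounded) blast
  obtain c1 \<gamma> where c1: "c1 > 0" "\<gamma> > 0" "\<And>s m. s > 0 \<Longrightarrow> m \<ge> 1 \<Longrightarrow> m * s \<le> K\<^sup>2 \<Longrightarrow> c1 * m powr \<gamma> * \<psi> s \<le> \<psi> (m * s)"
    by (rule psi_scaling_lower[of "K\<^sup>2"]) (use K in auto)
  show thesis
  proof
    show "c * c1 > 0" "2 * \<gamma> > 0" using c c1 by auto
    fix n and r :: real and u :: "real^'d"
    assume r: "r > 0" and nr: "real n * \<psi> (r\<^sup>2) = 1"
    show "indicator torus_cube (r *\<^sub>R u) * norm (sub_char_fun (r *\<^sub>R u) ^ n) \<le> exp (c * c1) * exp (- (c * c1) * norm u powr (2 * \<gamma>))"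
    proof (cases "r *\<^sub>R u \<in> torus_cube")
      case True
      have nn: "(norm (r *\<^sub>R u))\<^sup>2 = (norm u)\<^sup>2 * r\<^sup>2" using r by (simp add: power_mult_distrib)
      have "norm (sub_char_fun (r *\<^sub>R u) ^ n) \<le> exp (- c * \<psi> ((norm (r *\<^sub>R u))\<^sup>2)) ^ n"
        unfolding norm_power using c(2)[OF True] by (intro power_mono) auto
      also have "\<dots> = exp (- c * (real n * \<psi> ((norm u)\<^sup>2 * r\<^sup>2)))"
        unfolding nn by (simp add: exp_of_nat_mult[symmetric] mult_ac)
      also have "\<dots> \<le> exp (c * c1 + - (c * c1) * norm u powr (2 * \<gamma>))"
      proof -
        have "c1 * norm u powr (2 * \<gamma>) - c1 \<le> real n * \<psi> ((norm u)\<^sup>2 * r\<^sup>2)"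
        proof (cases "norm u \<ge> 1")
          case True
          have "(norm u)\<^sup>2 * r\<^sup>2 \<le> K\<^sup>2"
            using power_mono[OF K(2)[OF \<open>r *\<^sub>R u \<in> torus_cube\<close>], of 2] nn by simp
          with True have "c1 * ((norm u)\<^sup>2) powr \<gamma> * \<psi> (r\<^sup>2) \<le> \<psi> ((norm u)\<^sup>2 * r\<^sup>2)"
            using r by (intro c1) auto
          then have "real n * (c1 * ((norm u)\<^sup>2) powr \<gamma> * \<psi> (r\<^sup>2)) \<le> real n * \<psi> ((norm u)\<^sup>2 * r\<^sup>2)"
            by (intro mult_left_mono) auto
          moreover have "real n * (c1 * ((norm u)\<^sup>2) powr \<gamma> * \<psi> (r\<^sup>2)) = c1 * ((norm u)\<^sup>2) powr \<gamma>"
            using mult.left_commute[of "real n" "c1 * ((norm u)\<^sup>2) powr \<gamma>" "\<psi> (r\<^sup>2)"] nr by simp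
          moreover have "((norm u)\<^sup>2) powr \<gamma> = norm u powr (2 * \<gamma>)"
            using True powr_realpow[of "norm u" 2] powr_powr[of "norm u" 2 \<gamma>] by simp
          ultimately have "c1 * norm u powr (2 * \<gamma>) \<le> real n * \<psi> ((norm u)\<^sup>2 * r\<^sup>2)" by metis
          then show ?thesis using c1(1) by linarith
        next
          case False
          then have "norm u powr (2 * \<gamma>) \<le> 1 powr (2 * \<gamma>)" using c1 by (intro powr_mono2) auto
          then have "c1 * norm u powr (2 * \<gamma>) \<le> c1 * 1" using c1 by (intro mult_left_mono) auto
          moreover have "0 \<le> real n * \<psi> ((norm u)\<^sup>2 * r\<^sup>2)" by (intro mult_nonneg_nonneg psi_nonneg) auto
          ultimately show ?thesis by simp
        qed
        from mult_left_mono[OF this, of c] c(1) show ?thesis by (simp add: algebra_simps)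
      qed
      finally show ?thesis using True by (simp add: mult_exp_exp)
    qed simp
  qed
qed

lemma scaled_exponent_tendsto:
  assumes r: "filterlim r (at_right 0) F" and N: "\<forall>\<^sub>F k in F. N k * \<psi> ((r k)\<^sup>2) = 1" and u: "u \<noteq> 0"
  shows "((\<lambda>k. of_real (N k) * (1 - sub_char_fun (r k *\<^sub>R u))) \<longlongrightarrow> of_real ((quad u / 2) powr \<beta>)) F"
proof -
  let ?R = "subordinator_step b \<nu>"
  let ?z = "\<lambda>k. char_fun p (r k *\<^sub>R u)"
  let ?\<rho> = "\<lambda>k. 1 - Re (?z k)"
  obtain c \<delta> where c: "c > 0" "\<delta> > 0" "\<And>\<theta>. norm \<theta> \<le> \<delta> \<Longrightarrow> norm (char_fun p \<theta>) \<le> 1 - c * (norm \<theta>)\<^sup>2"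
    "\<And>\<theta>. norm \<theta> \<le> \<delta> \<Longrightarrow> 0 \<le> Re (char_fun p \<theta>)"
    by (rule norm_char_fun_near_0) blast
  obtain C where C: "C > 0" "\<And>\<theta>. \<bar>Im (char_fun p \<theta>)\<bar> \<le> C * norm \<theta> ^ 3" by (rule Im_char_fun_bound) blast
  have r0: "(r \<longlongrightarrow> 0) F" and rpos: "\<forall>\<^sub>F k in F. r k > 0"
    using r by (auto simp: filterlim_at elim: eventually_mono)
  have r2: "filterlim (\<lambda>k. (r k)\<^sup>2) (at_right 0) F"
    unfolding filterlim_at using rpos by (auto intro!: tendsto_eq_intros r0 elim: eventually_mono)
  have "((\<lambda>k. r k * norm u) \<longlongrightarrow> 0 * norm u) F" by (intro tendsto_intros r0)
  then have small: "\<forall>\<^sub>F k in F. r k * norm u < \<delta>" using c(2) by (intro order_tendstoD) auto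
  have "((\<lambda>k. \<psi> (?\<rho> k / (r k)\<^sup>2 * (r k)\<^sup>2) / \<psi> ((r k)\<^sup>2)) \<longlongrightarrow> (quad u / 2) powr \<beta>) F"
    using quad_pos[OF u] by (intro psi_ratio_tendsto r2 one_minus_Re_char_fun_tendsto r) auto
  moreover have "\<forall>\<^sub>F k in F. \<psi> (?\<rho> k / (r k)\<^sup>2 * (r k)\<^sup>2) / \<psi> ((r k)\<^sup>2) = N k * \<psi> (?\<rho> k)"
    using rpos N
  proof eventually_elim
    case (elim k)
    then have "\<psi> ((r k)\<^sup>2) > 0" by (intro psi_pos) auto
    with elim have "N k = 1 / \<psi> ((r k)\<^sup>2)" by (simp add: field_simps)
    with elim show ?case by simp
  qed
  ultimately have main: "((\<lambda>k. N k * \<psi> (?\<rho> k)) \<longlongrightarrow> (quad u / 2) powr \<beta>) F"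
    by (rule Lim_transform_eventually)
  show ?thesis
  proof (rule Lim_transform)
    show "((\<lambda>k. complex_of_real (N k * \<psi> (?\<rho> k))) \<longlongrightarrow> of_real ((quad u / 2) powr \<beta>)) F"
      using main by (rule tendsto_of_real)
    show "((\<lambda>k. of_real (N k) * (1 - sub_char_fun (r k *\<^sub>R u)) - complex_of_real (N k * \<psi> (?\<rho> k))) \<longlongrightarrow> 0) F"
    proof (rule Lim_null_comparison)
      have "((\<lambda>k. C / c * (r k * norm u) * (N k * \<psi> (?\<rho> k))) \<longlongrightarrow> C / c * (0 * norm u) * (quad u / 2) powr \<beta>) F"
        by (intro tendsto_intros r0 main)
      then show "((\<lambda>k. C / c * (r k * norm u) * (N k * \<psi> (?\<rho> k))) \<longlongrightarrow> 0) F" by simp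
      show "\<forall>\<^sub>F k in F. norm (of_real (N k) * (1 - sub_char_fun (r k *\<^sub>R u)) - complex_of_real (N k * \<psi> (?\<rho> k)))
         \<le> C / c * (r k * norm u) * (N k * \<psi> (?\<rho> k))"
        using rpos N small
      proof eventually_elim
        case (elim k)
        define t where "t = norm (r k *\<^sub>R u)"
        have t: "t = r k * norm u" "t > 0" "t \<le> \<delta>" using elim u by (auto simp: t_def)
        define m where "m = norm (?z k)"
        have m: "m \<le> 1 - c * t\<^sup>2" using c(3)[of "r k *\<^sub>R u"] t by (simp add: m_def t_def)
        have ct: "c * t\<^sup>2 > 0" using c(1) t(2) by simp
        have m01: "0 \<le> m" "m < 1" using m ct by (auto simp: m_def)
        have Re0: "0 \<le> Re (?z k)" using c(4)[of "r k *\<^sub>R u"] t by (simp add: t_def)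
        have Rem: "Re (?z k) \<le> m" using complex_Re_le_cmod[of "?z k"] by (simp add: m_def)
        have \<psi>pos: "\<psi> ((r k)\<^sup>2) > 0" using elim by (intro psi_pos) auto
        then have Npos: "N k > 0" using elim by (metis zero_less_mult_pos2 zero_less_one)
        have pgf_Re: "pgf ?R (of_real (Re (?z k))) = of_real (1 - \<psi> (?\<rho> k))"
          using Re0 Rem m01 by (simp add: pgf_subordinator_of_real)
        have "norm (pgf ?R (?z k) - pgf ?R (of_real (Re (?z k)))) \<le>
            norm (?z k - of_real (Re (?z k))) / (1 - m) * (1 - (1 - \<psi> (1 - m)))"
          using m01 Re0 Rem by (intro norm_pgf_diff_le subordinator_step_sums) (auto simp: m_def)
        also have "?z k - of_real (Re (?z k)) = \<i> * of_real (Im (?z k))"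
          by (simp add: complex_eq_iff)
        also have "norm (\<i> * complex_of_real (Im (?z k))) / (1 - m) * (1 - (1 - \<psi> (1 - m))) \<le>
            (C * t ^ 3) / (c * t\<^sup>2) * \<psi> (?\<rho> k)"
        proof (rule mult_mono)
          have "\<bar>Im (?z k)\<bar> \<le> C * t ^ 3" using C(2)[of "r k *\<^sub>R u"] by (simp add: t_def)
          then show "norm (\<i> * complex_of_real (Im (?z k))) / (1 - m) \<le> (C * t ^ 3) / (c * t\<^sup>2)"
            using ct m C t by (intro frac_le) (auto simp: norm_mult)
          show "1 - (1 - \<psi> (1 - m)) \<le> \<psi> (?\<rho> k)" using m01 Rem psi_mono[of "1 - m" "?\<rho> k"] by simp
          show "0 \<le> (C * t ^ 3) / (c * t\<^sup>2)" using ct C t by simp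
          show "0 \<le> 1 - (1 - \<psi> (1 - m))" using psi_nonneg[of "1 - m"] m01 by simp
        qed
        also have "(C * t ^ 3) / (c * t\<^sup>2) = C / c * t"
          using t c by (simp add: field_simps power3_eq_cube power2_eq_square)
        finally have bound: "norm (sub_char_fun (r k *\<^sub>R u) - of_real (1 - \<psi> (?\<rho> k))) \<le> C / c * t * \<psi> (?\<rho> k)"
          unfolding pgf_Re sub_char_fun_def .
        have "of_real (N k) * (1 - sub_char_fun (r k *\<^sub>R u)) - complex_of_real (N k * \<psi> (?\<rho> k)) =
          of_real (N k) * - (sub_char_fun (r k *\<^sub>R u) - of_real (1 - \<psi> (?\<rho> k)))"
          by (simp add: algebra_simps)
        also have "norm \<dots> = N k * norm (sub_char_fun (r k *\<^sub>R u) - of_real (1 - \<psi> (?\<rho> k)))"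
          unfolding norm_mult norm_minus_cancel using Npos by simp
        also have "\<dots> \<le> N k * (C / c * t * \<psi> (?\<rho> k))"
          using bound Npos by (intro mult_left_mono) auto
        finally show ?case by (simp add: t mult_ac)
      qed
    qed
  qed
qed

lemma norm_sub_char_fun_le_1: "norm (sub_char_fun \<theta>) \<le> 1"
proof -
  have "norm (pgf (subordinator_step b \<nu>) (char_fun p \<theta>)) \<le> 1"
    by (rule norm_sums_le[OF pgf_sums pmf_nat_sums_1[of "subordinator_step b \<nu>"]])
      (auto simp: norm_char_fun_le_1[OF finite_support] mult_left_le norm_power_le_1)
  then show ?thesis by (simp add: sub_char_fun_def)
qed

lemma scaled_power_tendsto:
  assumes r: "filterlim r (at_right 0) sequentially" and n: "filterlim n at_top sequentially"
    and N: "\<forall>\<^sub>F k in sequentially. real (n k) * \<psi> ((r k)\<^sup>2) = 1"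
  shows "(\<lambda>k. sub_char_fun (r k *\<^sub>R u) ^ n k) \<longlonglongrightarrow> of_real (exp (- ((quad u / 2) powr \<beta>)))"
proof (cases "u = 0")
  case True
  then show ?thesis by (simp add: sub_char_fun_0 quad_def)
next
  case False
  let ?L = "(quad u / 2) powr \<beta>"
  show ?thesis
  proof (rule Lim_transform)
    have "(\<lambda>k. (1 + (- ?L) / real (n k)) ^ n k) \<longlonglongrightarrow> exp (- ?L)"
      by (rule filterlim_compose[OF tendsto_exp_limit_sequentially n])
    then show "(\<lambda>k. complex_of_real ((1 + (- ?L) / real (n k)) ^ n k)) \<longlonglongrightarrow> of_real (exp (- ?L))"
      by (rule tendsto_of_real)
    show "(\<lambda>k. sub_char_fun (r k *\<^sub>R u) ^ n k - complex_of_real ((1 + (- ?L) / real (n k)) ^ n k)) \<longlonglongrightarrow> 0"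
    proof (rule Lim_null_comparison)
      have "(\<lambda>k. norm (of_real (real (n k)) * (1 - sub_char_fun (r k *\<^sub>R u)) - complex_of_real ?L)) \<longlonglongrightarrow> norm (of_real ?L - complex_of_real ?L)"
        by (intro tendsto_norm tendsto_diff tendsto_const scaled_exponent_tendsto r N False)
      then show "(\<lambda>k. norm (of_real (real (n k)) * (1 - sub_char_fun (r k *\<^sub>R u)) - complex_of_real ?L)) \<longlonglongrightarrow> 0"
        by simp
      have "\<forall>\<^sub>F k in sequentially. n k \<ge> nat \<lceil>?L\<rceil> + 1"
        using n by (simp add: filterlim_at_top)
      then show "\<forall>\<^sub>F k in sequentially. norm (sub_char_fun (r k *\<^sub>R u) ^ n k - complex_of_real ((1 + (- ?L) / real (n k)) ^ n k)) \<le>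
         norm (of_real (real (n k)) * (1 - sub_char_fun (r k *\<^sub>R u)) - complex_of_real ?L)"
      proof eventually_elim
        case (elim k)
        then have nL: "?L \<le> real (n k)" "real (n k) > 0" by linarith+
        let ?w = "1 + (- ?L) / real (n k)"
        have w: "norm (complex_of_real ?w) \<le> 1"
          using nL by (simp only: norm_of_real) (simp add: abs_le_iff field_simps)
        have "norm (sub_char_fun (r k *\<^sub>R u) ^ n k - complex_of_real ?w ^ n k) \<le> real (n k) * norm (sub_char_fun (r k *\<^sub>R u) - complex_of_real ?w)"
          by (intro norm_power_diff norm_sub_char_fun_le_1 w)
        also have "\<dots> = norm (complex_of_real (real (n k)) * (sub_char_fun (r k *\<^sub>R u) - complex_of_real ?w))"
          by (simp add: norm_mult)
        also have "complex_of_real (real (n k)) * (sub_char_fun (r k *\<^sub>R u) - complex_of_real ?w) =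
          - (of_real (real (n k)) * (1 - sub_char_fun (r k *\<^sub>R u)) - complex_of_real ?L)"
          using nL by (simp add: algebra_simps)
        finally show ?case by (simp only: norm_minus_cancel of_real_power)
      qed
    qed
  qed
qed

lemma transition_scaled:
  assumes r: "r > 0"
  shows "complex_of_real ((2 * pi) ^ CARD('d) * subordinate_transition b \<nu> p x n) =
    r ^ CARD('d) *\<^sub>R (\<integral>u. indicator torus_cube (r *\<^sub>R u) *\<^sub>R (sub_char_fun (r *\<^sub>R u) ^ n * cis (- (r * (real_vec x \<bullet> u)))) \<partial>lborel)"
proof -
  have "complex_of_real ((2 * pi) ^ CARD('d) * subordinate_transition b \<nu> p x n) =
    (\<integral>\<theta>. indicator torus_cube \<theta> *\<^sub>R (sub_char_fun \<theta> ^ n * cis (- (real_vec x \<bullet> \<theta>))) \<partial>lborel)"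
    unfolding subordinate_transition_def subordinate_walk_def sub_char_fun_def
    by (rule fourier_random_time[OF finite_support, symmetric])
  also have "\<dots> = r ^ DIM(real^'d) *\<^sub>R (\<integral>u. indicator torus_cube (r *\<^sub>R u) *\<^sub>R (sub_char_fun (r *\<^sub>R u) ^ n * cis (- (real_vec x \<bullet> (r *\<^sub>R u)))) \<partial>lborel)"
    by (rule lborel_integral_scale[OF _ r]) measurable
  finally show ?thesis by simp
qed

definition limit_constant :: real where
  "limit_constant = (\<integral>u. exp (- ((quad u / 2) powr \<beta>)) \<partial>lborel)"

lemma eventually_indicator_torus_cube:
  assumes r: "r \<longlonglongrightarrow> 0"
  shows "\<forall>\<^sub>F k in sequentially. (indicator torus_cube (r k *\<^sub>R (u::real^'d)) :: real) = 1"
proof -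
  have "(\<lambda>k. r k * norm u) \<longlonglongrightarrow> 0 * norm u" by (intro tendsto_intros r)
  from tendstoD[OF this pi_gt_zero] have "\<forall>\<^sub>F k in sequentially. \<bar>r k * norm u\<bar> < pi" by simp
  then show ?thesis
  proof eventually_elim
    case (elim k)
    have "\<bar>(r k *\<^sub>R u) $ i\<bar> \<le> pi" for i
      using component_le_norm_cart[of "r k *\<^sub>R u" i] elim by (simp add: abs_mult)
    then show ?case by (simp add: mem_torus_cube)
  qed
qed

lemma scaled_integral_tendsto:
  assumes r: "filterlim r (at_right 0) sequentially" and n: "filterlim n at_top sequentially"
    and N: "\<And>k. real (n k) * \<psi> ((r k)\<^sup>2) = 1" and rpos: "\<And>k. r k > 0"
    and y: "(\<lambda>k. r k *\<^sub>R y k) \<longlonglongrightarrow> 0"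
  shows "(\<lambda>k. \<integral>u. indicator torus_cube (r k *\<^sub>R u) *\<^sub>R (sub_char_fun (r k *\<^sub>R u) ^ n k * cis (- (r k * (y k \<bullet> u)))) \<partial>lborel)
      \<longlonglongrightarrow> complex_of_real limit_constant" (is ?lim)
    and "limit_constant > 0"
proof -
  let ?f = "\<lambda>u. exp (- ((quad u / 2) powr \<beta>))"
  let ?s = "\<lambda>k u. indicator torus_cube (r k *\<^sub>R u) *\<^sub>R (sub_char_fun (r k *\<^sub>R u) ^ n k * cis (- (r k * (y k \<bullet> u))))"
  have r0: "r \<longlonglongrightarrow> 0" using r by (simp add: filterlim_at)
  obtain \<kappa> \<delta> where dom: "\<kappa> > 0" "\<delta> > 0"
    "\<And>n r u. r > 0 \<Longrightarrow> real n * \<psi> (r\<^sup>2) = 1 \<Longrightarrow>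
      indicator torus_cube (r *\<^sub>R u) * norm (sub_char_fun (r *\<^sub>R u) ^ n) \<le> exp \<kappa> * exp (- \<kappa> * norm u powr \<delta>)"
    by (rule scaled_power_bound) blast
  have quad_measurable [measurable]: "quad \<in> borel_measurable borel"
    unfolding quad_def[abs_def] by (intro borel_measurable_continuous_onI continuous_intros)
  have meas_f: "(\<lambda>u. complex_of_real (?f u)) \<in> borel_measurable lborel" by measurable
  have [measurable]: "(\<lambda>u. cis (- (r k * (y k \<bullet> u)))) \<in> borel_measurable borel" for k
    by (intro borel_measurable_continuous_onI continuous_intros)
  have meas_s: "?s k \<in> borel_measurable lborel" for k by measurable
  have w: "integrable lborel (\<lambda>u::real^'d. exp \<kappa> * exp (- \<kappa> * norm u powr \<delta>))"
    by (intro integrable_mult_right integrable_stretched_exp dom)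
  have lim: "AE u in lborel. (\<lambda>k. ?s k u) \<longlonglongrightarrow> complex_of_real (?f u)"
  proof (rule AE_I2)
    fix u
    have "(\<lambda>k. (r k *\<^sub>R y k) \<bullet> u) \<longlonglongrightarrow> 0 \<bullet> u" by (intro tendsto_intros y)
    then have c: "(\<lambda>k. cis (- (r k * (y k \<bullet> u)))) \<longlonglongrightarrow> cis (- 0)"
      by (intro tendsto_cis tendsto_minus) simp
    have "(\<lambda>k. 1 *\<^sub>R (sub_char_fun (r k *\<^sub>R u) ^ n k * cis (- (r k * (y k \<bullet> u))))) \<longlonglongrightarrow> 1 *\<^sub>R (of_real (?f u) * cis (- 0))"
      by (rule tendsto_scaleR[OF tendsto_const tendsto_mult[OF scaled_power_tendsto[OF r n] c]]) (simp add: N)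
    then show "(\<lambda>k. ?s k u) \<longlonglongrightarrow> complex_of_real (?f u)"
      using eventually_indicator_torus_cube[OF r0, of u]
      by (simp add: Lim_transform_eventually eventually_mono)
  qed
  have bound: "AE u in lborel. norm (?s k u) \<le> exp \<kappa> * exp (- \<kappa> * norm u powr \<delta>)" for k
    using dom(3)[OF rpos N] by (intro AE_I2) (simp add: norm_mult)
  have int: "integrable lborel (\<lambda>u. complex_of_real (?f u))"
    by (rule integrable_dominated_convergence[OF meas_f meas_s w lim bound])
  have "(\<lambda>k. integral\<^sup>L lborel (?s k)) \<longlonglongrightarrow> (\<integral>u. complex_of_real (?f u) \<partial>lborel)"
    by (rule integral_dominated_convergence[OF meas_f meas_s w lim bound])
  then show ?lim by (simp add: limit_constant_def)
  have intr: "integrable lborel ?f" using int by (simp add: complex_of_real_integrable_eq)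
  have "limit_constant \<noteq> 0"
  proof
    assume "limit_constant = 0"
    then have "AE u::real^'d in lborel. ?f u = 0"
      unfolding limit_constant_def using integral_nonneg_eq_0_iff_AE[OF intr] by simp
    then have "AE u::real^'d in lborel. False" by simp
    then show False by (simp add: eventually_False ae_filter_eq_bot_iff)
  qed
  moreover have "limit_constant \<ge> 0" unfolding limit_constant_def by (intro integral_nonneg_AE AE_I2) simp
  ultimately show "limit_constant > 0" by simp
qed

lemma psi_scale_exists:
  assumes "n \<ge> 1"
  shows "\<exists>r>0. real n * \<psi> (r\<^sup>2) = 1"
proof -
  have "\<exists>x\<ge>0. x \<le> 1 \<and> \<psi> x = 1 / real n" 
    using assms continuous_on_subset[OF psi_continuous] by (intro IVT') (auto simp: psi_0 psi_1)
  then obtain x where x: "x \<ge> 0" "\<psi> x = 1 / real n" by auto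
  then have "x \<noteq> 0" using assms psi_0 by auto
  with x assms show ?thesis by (intro exI[of _ "sqrt x"]) auto
qed

lemma scale_tendsto_0:
  assumes n: "filterlim n at_top sequentially"
    and N: "\<And>k. real (n k) * \<psi> ((r k)\<^sup>2) = 1" and rpos: "\<And>k. r k > 0"
  shows "filterlim r (at_right 0) sequentially"
proof -
  have "r \<longlonglongrightarrow> 0"
  proof (rule tendstoI)
    fix e :: real assume e: "e > 0"
    then have "\<psi> (e\<^sup>2) > 0" by (intro psi_pos) simp
    have "filterlim (\<lambda>k. real (n k)) at_top sequentially"
      by (rule filterlim_compose[OF filterlim_real_sequentially n])
    then have "\<forall>\<^sub>F k in sequentially. 1 / \<psi> (e\<^sup>2) < real (n k)"
      by (simp add: filterlim_at_top_dense)
    then show "\<forall>\<^sub>F k in sequentially. dist (r k) 0 < e"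
    proof eventually_elim
      case (elim k)
      have "r k < e"
      proof (rule ccontr)
        assume "\<not> r k < e"
        then have "\<psi> (e\<^sup>2) \<le> \<psi> ((r k)\<^sup>2)" using e by (intro psi_mono power_mono) auto
        then have "real (n k) * \<psi> (e\<^sup>2) \<le> 1" using N[of k] mult_left_mono[of _ _ "real (n k)"] by fastforce
        with elim \<open>\<psi> (e\<^sup>2) > 0\<close> show False by (simp add: field_simps)
      qed
      then show ?case using rpos[of k] by simp
    qed
  qed
  moreover have "r k \<noteq> 0" for k using rpos[of k] by simp
  ultimately show ?thesis using rpos by (simp add: filterlim_at)
qed

lemma scaled_points_tendsto_0:
  assumes N: "\<And>k. real (n k) * \<psi> ((r k)\<^sup>2) = 1" and rpos: "\<And>k. r k > 0"
    and lim: "filterlim (\<lambda>k. real (n k) * \<psi> (1 / (walk_norm p (x k))\<^sup>2)) at_top sequentially"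
  shows "(\<lambda>k. r k *\<^sub>R real_vec (x k)) \<longlonglongrightarrow> 0"
proof -
  obtain C where C: "C > 0" "\<And>x. norm (real_vec x) \<le> C * walk_norm p x" by (rule norm_le_walk_norm) blast
  have wn: "walk_norm p x \<ge> 0" for x
  proof -
    have "0 \<le> C * walk_norm p x" by (rule order_trans[OF norm_ge_zero C(2)])
    with C(1) show ?thesis by (simp add: zero_le_mult_iff)
  qed
  show ?thesis
  proof (rule tendstoI)
    fix e :: real assume e: "e > 0"
    define A where "A = max 1 ((C / e)\<^sup>2)"
    have "\<forall>\<^sub>F k in sequentially. A < real (n k) * \<psi> (1 / (walk_norm p (x k))\<^sup>2)"
      using lim by (simp add: filterlim_at_top_dense)
    then show "\<forall>\<^sub>F k in sequentially. dist (r k *\<^sub>R real_vec (x k)) 0 < e"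
    proof eventually_elim
      case (elim k)
      let ?w = "walk_norm p (x k)"
      have A1: "A \<ge> 1" by (simp add: A_def)
      have less: "A * (r k)\<^sup>2 < 1 / ?w\<^sup>2"
      proof (rule ccontr)
        assume "\<not> ?thesis"
        then have "\<psi> (1 / ?w\<^sup>2) \<le> \<psi> (A * (r k)\<^sup>2)" by (intro psi_mono) auto
        also have "\<dots> \<le> A * \<psi> ((r k)\<^sup>2)" using A1 by (intro psi_mult_le) auto
        finally have "real (n k) * \<psi> (1 / ?w\<^sup>2) \<le> real (n k) * (A * \<psi> ((r k)\<^sup>2))"
          by (intro mult_left_mono) auto
        also have "\<dots> = A" using N[of k] by (simp add: mult.left_commute)
        finally show False using elim by simp
      qed
      moreover have "0 < A * (r k)\<^sup>2" using A1 rpos[of k] by (intro mult_pos_pos) auto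
      ultimately have "?w \<noteq> 0" by auto
      then have w: "?w > 0" using wn[of "x k"] by simp
      have "(C / e)\<^sup>2 * (r k)\<^sup>2 \<le> A * (r k)\<^sup>2" by (intro mult_right_mono) (auto simp: A_def)
      with less have "(C / e * r k)\<^sup>2 < (1 / ?w)\<^sup>2" by (simp add: power_mult_distrib power_divide)
      then have "C / e * r k < 1 / ?w" by (rule power2_less_imp_less) (use w in simp)
      then have "r k * (C * ?w) < e" using w e by (simp add: field_simps)
      moreover have "norm (r k *\<^sub>R real_vec (x k)) \<le> r k * (C * ?w)"
        using C(2)[of "x k"] rpos[of k] by (simp add: mult_left_mono)
      ultimately show ?case by simp
    qed
  qed
qed

lemma transition_ratio_tendsto:
  assumes n: "filterlim n at_top sequentially"
    and lim: "filterlim (\<lambda>k. real (n k) * \<psi> (1 / (walk_norm p (x k))\<^sup>2)) at_top sequentially"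
    and n1: "\<And>k. n k \<ge> 1"
  shows "(\<lambda>k. subordinate_transition b \<nu> p (x k) (n k) / subordinate_transition b \<nu> p 0 (n k)) \<longlonglongrightarrow> 1"
proof -
  have "\<forall>k. \<exists>r>0. real (n k) * \<psi> (r\<^sup>2) = 1" using psi_scale_exists[OF n1] by blast
  then obtain r where rpos: "\<And>k. r k > 0" and N: "\<And>k. real (n k) * \<psi> ((r k)\<^sup>2) = 1" by metis
  note r = scale_tendsto_0[OF n N rpos]
  define I where "I y k = (\<integral>u. indicator torus_cube (r k *\<^sub>R u) *\<^sub>R (sub_char_fun (r k *\<^sub>R u) ^ n k * cis (- (r k * (real_vec y \<bullet> u)))) \<partial>lborel)" for y k
  have Ix: "(\<lambda>k. I (x k) k) \<longlonglongrightarrow> complex_of_real limit_constant"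
    unfolding I_def by (rule scaled_integral_tendsto[OF r n N rpos scaled_points_tendsto_0[OF N rpos lim]])
  have I0: "(\<lambda>k. I 0 k) \<longlonglongrightarrow> complex_of_real limit_constant"
    unfolding I_def by (rule scaled_integral_tendsto(1)[OF r n N rpos]) (simp add: real_vec_zero)
  have pos: "limit_constant > 0"
    by (rule scaled_integral_tendsto(2)[OF r n N rpos scaled_points_tendsto_0[OF N rpos lim]])
  have "complex_of_real (subordinate_transition b \<nu> p (x k) (n k) / subordinate_transition b \<nu> p 0 (n k)) = I (x k) k / I 0 k" for k
  proof -
    have "complex_of_real (subordinate_transition b \<nu> p (x k) (n k) / subordinate_transition b \<nu> p 0 (n k)) =
      complex_of_real ((2 * pi) ^ CARD('d) * subordinate_transition b \<nu> p (x k) (n k)) / complex_of_real ((2 * pi) ^ CARD('d) * subordinate_transition b \<nu> p 0 (n k))"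
      by simp
    also have "\<dots> = I (x k) k / I 0 k"
      unfolding transition_scaled[OF rpos[of k]] I_def[symmetric] using rpos[of k] by (simp add: scaleR_conv_of_real)
    finally show ?thesis .
  qed
  moreover have "(\<lambda>k. I (x k) k / I 0 k) \<longlonglongrightarrow> complex_of_real limit_constant / complex_of_real limit_constant"
    using pos by (intro tendsto_divide Ix I0) simp
  ultimately have "(\<lambda>k. complex_of_real (subordinate_transition b \<nu> p (x k) (n k) / subordinate_transition b \<nu> p 0 (n k))) \<longlonglongrightarrow> of_real 1"
    using pos by simp
  then show ?thesis by (simp only: tendsto_of_real_iff)
qed

end

theorem corollary5p2:
  fixes \<alpha> a b :: real and \<psi> :: "real \<Rightarrow> real" and \<nu> :: "real measure"
    and p :: "(int ^ 'd) pmf"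
    and x :: "nat \<Rightarrow> int ^ 'd" and n :: "nat \<Rightarrow> nat"
  assumes "0 < \<alpha>" and "\<alpha> < 2"
    and "bernstein_function \<psi>" and "bernstein_repr \<psi> a b \<nu>"
    and "regularly_varying_at_zero (\<alpha> / 2) \<psi>"
    and "\<psi> 0 = 0" and "\<psi> 1 = 1"
    and "walk_class p"
    and "filterlim n at_top sequentially"
    and "filterlim (\<lambda>k. walk_norm p (x k)) at_top sequentially"
    and "filterlim (\<lambda>k. real (n k) * \<psi> (1 / (walk_norm p (x k))\<^sup>2)) at_top sequentially"
  shows "(\<lambda>k. subordinate_transition b \<nu> p (x k) (n k) /
              subordinate_transition b \<nu> p 0 (n k)) \<longlonglongrightarrow> 1"
proof -
  interpret subordinated_walk \<psi> a b \<nu> "\<alpha> / 2" p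
    by unfold_locales (use assms in \<open>auto simp: bernstein_function_def\<close>)
  obtain k0 where k0: "\<And>k. k \<ge> k0 \<Longrightarrow> n k \<ge> 1"
    using assms(9) by (auto simp: filterlim_at_top eventually_sequentially)
  have "(\<lambda>k. subordinate_transition b \<nu> p (x (k + k0)) (n (k + k0)) /
      subordinate_transition b \<nu> p 0 (n (k + k0))) \<longlonglongrightarrow> 1"
  proof (rule transition_ratio_tendsto)
    show "filterlim (\<lambda>k. n (k + k0)) at_top sequentially"
      by (rule filterlim_compose[OF assms(9) filterlim_add_const_nat_at_top])
    show "filterlim (\<lambda>k. real (n (k + k0)) * \<psi> (1 / (walk_norm p (x (k + k0)))\<^sup>2)) at_top sequentially"
      by (rule filterlim_compose[OF assms(11) filterlim_add_const_nat_at_top])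
  qed (use k0 in auto)
  then show ?thesis by (rule LIMSEQ_offset)
qed

end
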